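(* Let $(X,d,f)$ be a topological dynamical system with the specification property. Then for each $S\in\{UC,P\}$, $$\overline{\rm mdim}_M^{S}(f\times f,{\rm MLY}(f),d\times d)=2\,\overline{\rm mdim}_M(f,X,d),$$ $$\underline{\rm mdim}_M^{S}(f\times f,{\rm MLY}(f),d\times d)=2\,\underline{\rm mdim}_M(f,X,d).$$
   Context: A topological dynamical system (TDS) $(X,d,f)$ consists of a compact metric space $(X,d)$ and a homeomorphism $f:X\to X$. Specification property: for any $\epsilon>0$ there is a positive integer $m=m(\epsilon)$ such that for any finite collection of intervals $I_j=[a_j,b_j]\subset\mathbb N$, $j=1,\dots,k$, with $a_{j+1}-b_j\ge m(\epsilon)$ for $j=1,\dots,k-1$, and any points $x_1,\dots,x_k\in X$, there is $x\in X$ with $d(f^{p}x_j,f^{p+a_j}x)<\epsilon$ for all $p=0,\dots,b_j-a_j$ and $j=1,\dots,k$. The product system is $(X\times X,d\times d,f\times f)$ with $(d\times d)((x_1,y_1),(x_2,y_2))=\max\{d(x_1,x_2),d(y_1,y_2)\}$ and $(f\times f)(x,y)=(fx,fy)$. A pair $(x,y)\in X\times X$ is a mean Li–Yorke pair if $\liminf_{n\to\infty}\frac1n\sum_{i=0}^{n-1}d(f^ix,f^iy)=0$ and $\limsup_{n\to\infty}\frac1n\sum_{i=0}^{n-1}d(f^ix,f^iy)>0$. ${\rm MLY}(f)\subset X\times X$ is the set of all mean Li–Yorke pairs. Metric mean dimensions of a subset $Z$ of a TDS $(Y,\rho,g)$ (applied here with $(Y,\rho,g)=(X,d,f)$ and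 $(X\times X,d\times d,f\times f)$): $\rho_n(x,y)=\max_{0\le i\le n-1}\rho(g^ix,g^iy)$, $\overline B_n(x,\epsilon)=\{y:\rho_n(x,y)\le\epsilon\}$; $s>0$, $N\in\mathbb N$, $\epsilon>0$. (UC) For non-empty $Z$, $E\subset Z$ is $(n,\epsilon)$-separated if $\rho_n(x,y)>\epsilon$ for all distinct $x,y\in E$; $s_n(Z,\epsilon)$ is the largest cardinality of such sets; $h^{UC}_{top}(g,Z,\epsilon)=\limsup_{n\to\infty}\frac1n\log s_n(Z,\epsilon)$. (P) $P(Z,s,N,\epsilon)=\sup\sum_{i\in I}e^{-sn_i}$ over all finite or countable pairwise disjoint families $\{\overline B_{n_i}(x_i,\epsilon)\}_{i\in I}$ with $x_i\in Z$, $n_i\ge N$; $P(Z,s,\epsilon)=\lim_{N\to\infty}P(Z,s,N,\epsilon)$; $\mathcal P(Z,s,\epsilon)=\inf\{\sum_{i=1}^\infty P(Z_i,s,\epsilon):\bigcup_{i\ge1}Z_i\supseteq Z\}$; $h^P_{top}(g,Z,\epsilon)=\inf\{s>0:\mathcal P(Z,s,\epsilon)=0\}$. For $S\in\{UC,P\}$, $\overline{\rm mdim}_M^S(g,Z,\rho)=\limsup_{\epsilon\to0}h^S_{top}(g,Z,\epsilon)/|\log\epsilon|$ and $\underline{\rm mdim}_M^S(g,Z,\rho)=\liminf_{\epsilon\to0}h^S_{top}(g,Z,\epsilon)/|\log\epsilon|$; $\overline{\rm mdim}_M(f,X,d)=\overline{\rm mdim}_M^{UC}(f,X,d)$ and $\underline{\rm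 mdim}_M(f,X,d)=\underline{\rm mdim}_M^{UC}(f,X,d)$. *)

theory Defs
  imports "HOL-Analysis.Analysis"
begin

text \<open>A system (Y, rho, g) is given by a carrier set, a distance function and a self-map. The
  distance is an explicit argument because the product system carries the maximum metric,
  whereas \<^const>\<open>dist\<close> on the product type is the Euclidean one.\<close>

definition specification_property ::
    "'a set \<Rightarrow> ('a \<Rightarrow> 'a \<Rightarrow> real) \<Rightarrow> ('a \<Rightarrow> 'a) \<Rightarrow> bool" where
  "specification_property Y \<rho> g \<longleftrightarrow>
    (\<forall>\<epsilon>>0. \<exists>m::nat. m > 0 \<and>
      (\<forall>(k::nat) (a::nat \<Rightarrow> nat) (b::nat \<Rightarrow> nat) (x::nat \<Rightarrow> 'a).
         k \<ge> 1 \<longrightarrow>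
         (\<forall>j\<in>{1..k}. a j \<le> b j \<and> x j \<in> Y) \<longrightarrow>
         (\<forall>j\<in>{1..<k}. b j + m \<le> a (j + 1)) \<longrightarrow>
         (\<exists>z\<in>Y. \<forall>j\<in>{1..k}. \<forall>p\<in>{0..b j - a j}.
            \<rho> ((g ^^ p) (x j)) ((g ^^ (p + a j)) z) < \<epsilon>)))"

definition max_dist :: "('a \<Rightarrow> 'a \<Rightarrow> real) \<Rightarrow> 'a \<times> 'a \<Rightarrow> 'a \<times> 'a \<Rightarrow> real" where
  "max_dist \<rho> p q = max (\<rho> (fst p) (fst q)) (\<rho> (snd p) (snd q))"

definition MLY :: "'a set \<Rightarrow> ('a \<Rightarrow> 'a \<Rightarrow> real) \<Rightarrow> ('a \<Rightarrow> 'a) \<Rightarrow> ('a \<times> 'a) set" where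
  "MLY Y \<rho> g = {(x, y) \<in> Y \<times> Y.
     liminf (\<lambda>n. ereal (1 / real n * (\<Sum>i<n. \<rho> ((g ^^ i) x) ((g ^^ i) y)))) = 0 \<and>
     limsup (\<lambda>n. ereal (1 / real n * (\<Sum>i<n. \<rho> ((g ^^ i) x) ((g ^^ i) y)))) > 0}"

text \<open>Meaningful for n > 0 only. The value at n = 0 is immaterial below: it enters only
  expressions of which a limit in n or N is taken.\<close>

definition bowen_dist :: "('a \<Rightarrow> 'a \<Rightarrow> real) \<Rightarrow> ('a \<Rightarrow> 'a) \<Rightarrow> nat \<Rightarrow> 'a \<Rightarrow> 'a \<Rightarrow> real" where
  "bowen_dist \<rho> g n x y = (MAX i\<in>{..<n}. \<rho> ((g ^^ i) x) ((g ^^ i) y))"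

definition bowen_cball ::
    "'a set \<Rightarrow> ('a \<Rightarrow> 'a \<Rightarrow> real) \<Rightarrow> ('a \<Rightarrow> 'a) \<Rightarrow> nat \<Rightarrow> 'a \<Rightarrow> real \<Rightarrow> 'a set" where
  "bowen_cball Y \<rho> g n x \<epsilon> = {y \<in> Y. bowen_dist \<rho> g n x y \<le> \<epsilon>}"

definition separated ::
    "('a \<Rightarrow> 'a \<Rightarrow> real) \<Rightarrow> ('a \<Rightarrow> 'a) \<Rightarrow> nat \<Rightarrow> real \<Rightarrow> 'a set \<Rightarrow> bool" where
  "separated \<rho> g n \<epsilon> E \<longleftrightarrow> (\<forall>x\<in>E. \<forall>y\<in>E. x \<noteq> y \<longrightarrow> bowen_dist \<rho> g n x y > \<epsilon>)"

text \<open>In a compact system and for n > 0 the set of cardinalities is bounded, so this supremum is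
  a maximum.\<close>

definition sep_num ::
    "('a \<Rightarrow> 'a \<Rightarrow> real) \<Rightarrow> ('a \<Rightarrow> 'a) \<Rightarrow> 'a set \<Rightarrow> nat \<Rightarrow> real \<Rightarrow> nat" where
  "sep_num \<rho> g Z n \<epsilon> = Sup {card E |E. E \<subseteq> Z \<and> finite E \<and> separated \<rho> g n \<epsilon> E}"

text \<open>The classical definition is for non-empty Z. Since \<^term>\<open>ln (0::real) = 0\<close>, the empty set
  gets the value 0, as it does for the packing entropy.\<close>

definition entropy_UC ::
    "('a \<Rightarrow> 'a \<Rightarrow> real) \<Rightarrow> ('a \<Rightarrow> 'a) \<Rightarrow> 'a set \<Rightarrow> real \<Rightarrow> ereal" where
  "entropy_UC \<rho> g Z \<epsilon> = limsup (\<lambda>n. ereal (1 / real n * ln (real (sep_num \<rho> g Z n \<epsilon>))))"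

text \<open>Finite or countable families of balls are indexed by arbitrary sets of naturals.\<close>

definition packing_sum_N ::
    "'a set \<Rightarrow> ('a \<Rightarrow> 'a \<Rightarrow> real) \<Rightarrow> ('a \<Rightarrow> 'a) \<Rightarrow> 'a set \<Rightarrow> real \<Rightarrow> nat \<Rightarrow> real \<Rightarrow> ennreal" where
  "packing_sum_N Y \<rho> g Z s N \<epsilon> =
     Sup {(\<Sum>\<^sub>\<infinity>i\<in>I. ennreal (exp (- s * real (n i)))) |(I::nat set) (x::nat \<Rightarrow> 'a) (n::nat \<Rightarrow> nat).
            (\<forall>i\<in>I. x i \<in> Z \<and> n i \<ge> N) \<and>
            disjoint_family_on (\<lambda>i. bowen_cball Y \<rho> g (n i) (x i) \<epsilon>) I}"

definition packing_sum ::
    "'a set \<Rightarrow> ('a \<Rightarrow> 'a \<Rightarrow> real) \<Rightarrow> ('a \<Rightarrow> 'a) \<Rightarrow> 'a set \<Rightarrow> real \<Rightarrow> real \<Rightarrow> ennreal" where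
  "packing_sum Y \<rho> g Z s \<epsilon> = lim (\<lambda>N. packing_sum_N Y \<rho> g Z s N \<epsilon>)"

definition packing_measure ::
    "'a set \<Rightarrow> ('a \<Rightarrow> 'a \<Rightarrow> real) \<Rightarrow> ('a \<Rightarrow> 'a) \<Rightarrow> 'a set \<Rightarrow> real \<Rightarrow> real \<Rightarrow> ennreal" where
  "packing_measure Y \<rho> g Z s \<epsilon> =
     Inf {(\<Sum>i. packing_sum Y \<rho> g (W i) s \<epsilon>) |W::nat \<Rightarrow> 'a set.
            (\<forall>i. W i \<subseteq> Y) \<and> Z \<subseteq> (\<Union>i. W i)}"

definition entropy_P ::
    "'a set \<Rightarrow> ('a \<Rightarrow> 'a \<Rightarrow> real) \<Rightarrow> ('a \<Rightarrow> 'a) \<Rightarrow> 'a set \<Rightarrow> real \<Rightarrow> ereal" where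
  "entropy_P Y \<rho> g Z \<epsilon> = Inf {ereal s |s. s > 0 \<and> packing_measure Y \<rho> g Z s \<epsilon> = 0}"

datatype entropy_kind = UC | P

fun entropy ::
    "entropy_kind \<Rightarrow> 'a set \<Rightarrow> ('a \<Rightarrow> 'a \<Rightarrow> real) \<Rightarrow> ('a \<Rightarrow> 'a) \<Rightarrow> 'a set \<Rightarrow> real \<Rightarrow> ereal" where
  "entropy UC Y \<rho> g Z \<epsilon> = entropy_UC \<rho> g Z \<epsilon>"
| "entropy P Y \<rho> g Z \<epsilon> = entropy_P Y \<rho> g Z \<epsilon>"

definition upper_mdim ::
    "entropy_kind \<Rightarrow> 'a set \<Rightarrow> ('a \<Rightarrow> 'a \<Rightarrow> real) \<Rightarrow> ('a \<Rightarrow> 'a) \<Rightarrow> 'a set \<Rightarrow> ereal" where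
  "upper_mdim S Y \<rho> g Z = Limsup (at_right 0) (\<lambda>\<epsilon>. entropy S Y \<rho> g Z \<epsilon> / ereal \<bar>ln \<epsilon>\<bar>)"

definition lower_mdim ::
    "entropy_kind \<Rightarrow> 'a set \<Rightarrow> ('a \<Rightarrow> 'a \<Rightarrow> real) \<Rightarrow> ('a \<Rightarrow> 'a) \<Rightarrow> 'a set \<Rightarrow> ereal" where
  "lower_mdim S Y \<rho> g Z = Liminf (at_right 0) (\<lambda>\<epsilon>. entropy S Y \<rho> g Z \<epsilon> / ereal \<bar>ln \<epsilon>\<bar>)"

end

theory Submission
  imports Defs
begin

text \<open>Up to replacing \<epsilon> by a multiple of \<epsilon>, which no limit of the form
  h(\<epsilon>) / |ln \<epsilon>| notices, both entropies of MLY equal 2 h(\<epsilon>), where h is the separated-set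
  entropy of X. From above: the packing entropy is at most the separated-set entropy, and pairs of
  points of a maximal separated set of X span the square. From below: by specification, MLY
  contains a dense G-delta subset of the square, so by Baire some member W of any countable cover of
  MLY is dense in an open box. Specification again provides, after a bounded delay, orbit segments
  starting in that box and shadowing any pair of points of a separated set E of X. This gives
  (card E)^2 points of W that are separated well enough for their Bowen balls to be disjoint, hence
  W, and so the cover, has large packing sums.\<close>

section \<open>Bowen metrics and separated sets\<close>

text \<open>The obstacle is that the covers in the packing entropy consist of arbitrary sets, over
  which a single large subset built inside MLY gives no control. Category survives a cut into
  countably many pieces, but it yields only density of one piece in a box. Density suffices because
  separation along finitely many times is an open condition: a shadowing pair can be moved to a
  nearby point of W without losing it. The delay depends on \<epsilon> and the box, not on the
  length n, so it costs a fixed factor that exponential growth absorbs. The lower bound is needed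
  only for the packing entropy and the upper bound only for the separated-set entropy, since the
  former is at most the latter.\<close>

lemma bowen_dist_le_iff:
  "n > 0 \<Longrightarrow> bowen_dist \<rho> g n x y \<le> e \<longleftrightarrow> (\<forall>i<n. \<rho> ((g ^^ i) x) ((g ^^ i) y) \<le> e)"
  unfolding bowen_dist_def by (subst Max_le_iff) auto

lemma less_bowen_dist_iff:
  "n > 0 \<Longrightarrow> e < bowen_dist \<rho> g n x y \<longleftrightarrow> (\<exists>i<n. e < \<rho> ((g ^^ i) x) ((g ^^ i) y))"
  using bowen_dist_le_iff[of n \<rho> g x y e]  by (meson not_le)

lemma bowen_dist_dist_commute: "bowen_dist dist g n x y = bowen_dist dist g n y x"
  unfolding bowen_dist_def by (simp add: dist_commute)

lemma funpow_map_prod: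
  fixes f :: "'a \<Rightarrow> 'a" and g :: "'b \<Rightarrow> 'b"
  shows "(map_prod f g ^^ i) p = ((f ^^ i) (fst p), (g ^^ i) (snd p))"
  by (induction i) auto

lemma max_dist_triangle: "max_dist dist p r \<le> max_dist dist p q + max_dist dist q r"
  unfolding max_dist_def
  using dist_triangle[of "fst p" "fst r" "fst q"] dist_triangle[of "snd p" "snd r" "snd q"] by auto

lemma max_dist_commute: "max_dist dist p q = max_dist dist q p"
  by (simp add: max_dist_def dist_commute)

text \<open>\<open>Sup\<close> on \<open>nat\<close> is meaningful only for bounded sets, so reading
  \<open>sep_num\<close> as a maximum always goes through this predicate.\<close>

definition sep_bounded where
  "sep_bounded \<rho> g Z n \<epsilon> \<longleftrightarrow>
     (\<exists>B. \<forall>E. E \<subseteq> Z \<longrightarrow> finite E \<longrightarrow> separated \<rho> g n \<epsilon> E \<longrightarrow> card E \<le> B)"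

lemma separated_empty [simp]: "separated \<rho> g n \<epsilon> {}"
  by (simp add: separated_def)

lemma finite_sep_cards:
  assumes "sep_bounded \<rho> g Z n \<epsilon>"
  shows "finite {card E |E. E \<subseteq> Z \<and> finite E \<and> separated \<rho> g n \<epsilon> E}"
proof -
  obtain B where "\<forall>E. E \<subseteq> Z \<longrightarrow> finite E \<longrightarrow> separated \<rho> g n \<epsilon> E \<longrightarrow> card E \<le> B"
    using assms unfolding sep_bounded_def by blast
  then have "{card E |E. E \<subseteq> Z \<and> finite E \<and> separated \<rho> g n \<epsilon> E} \<subseteq> {..B}"
    by auto
  then show ?thesis by (rule finite_subset) simp
qed

lemma card_le_sep_num:
  assumes "sep_bounded \<rho> g Z n \<epsilon>" "E \<subseteq> Z" "finite E" "separated \<rho> g n \<epsilon> E"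
  shows "card E \<le> sep_num \<rho> g Z n \<epsilon>"
  unfolding sep_num_def
  by (rule cSup_upper) (use assms finite_sep_cards[OF assms(1)] in \<open>auto intro: bdd_above_finite\<close>)

lemma sep_num_attained:
  assumes "sep_bounded \<rho> g Z n \<epsilon>"
  obtains E where "E \<subseteq> Z" "finite E" "separated \<rho> g n \<epsilon> E" "card E = sep_num \<rho> g Z n \<epsilon>"
proof -
  let ?S = "{card E |E. E \<subseteq> Z \<and> finite E \<and> separated \<rho> g n \<epsilon> E}"
  have "?S \<noteq> {}" by (auto intro!: exI[of _ "{}"])
  then have "Sup ?S \<in> ?S"
    using finite_sep_cards[OF assms] by (metis (no_types, lifting) Max_in cSup_eq_Max)
  then show ?thesis unfolding sep_num_def[symmetric] using that by auto
qed

lemma entropy_UC_nonneg: "0 \<le> entropy_UC \<rho> g Z \<epsilon>"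
proof -
  \<comment> \<open>For n = 0 this is the default \<open>ln 0 = 0\<close>.\<close>
  have "0 \<le> ln (real n)" for n :: nat by (cases n) auto
  then show ?thesis unfolding entropy_UC_def by (intro le_Limsup) (auto simp: zero_ereal_def)
qed

section \<open>Packing entropy is at most separated-set entropy\<close>

lemma packing_sum_N_antimono: "antimono (\<lambda>N. packing_sum_N Y \<rho> g Z s N \<epsilon>)"
  unfolding packing_sum_N_def
  by (intro antimonoI Sup_subset_mono) (use order_trans in blast)

lemma packing_sum_eq_INF: "packing_sum Y \<rho> g Z s \<epsilon> = (INF N. packing_sum_N Y \<rho> g Z s N \<epsilon>)"
  unfolding packing_sum_def by (intro limI LIMSEQ_INF packing_sum_N_antimono)

text \<open>Sort the balls by length: the centres of the disjoint balls of length m form an (m,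
  \<epsilon>)-separated set, so there are at most \<open>sep_num\<close> many of them.\<close>

lemma packing_sum_N_le:
  assumes bdd: "\<And>n. n > 0 \<Longrightarrow> sep_bounded \<rho> g Z n \<epsilon>"
    and "Z \<subseteq> Y" and self: "\<And>x. \<rho> x x = 0" and "\<epsilon> > 0" "N > 0"
  shows "packing_sum_N Y \<rho> g Z s N \<epsilon>
           \<le> (\<Sum>k. ennreal (real (sep_num \<rho> g Z (k + N) \<epsilon>) * exp (- s * real (k + N))))"
    (is "_ \<le> ?B")
  unfolding packing_sum_N_def
proof (rule Sup_least, clarify)
  fix I :: "nat set" and x n
  assume xn: "\<forall>i\<in>I. x i \<in> Z \<and> N \<le> n i"
    and disj: "disjoint_family_on (\<lambda>i. bowen_cball Y \<rho> g (n i) (x i) \<epsilon>) I"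
  have centre: "x i \<in> bowen_cball Y \<rho> g (n i) (x i) \<epsilon>" if "i \<in> I" for i
    using that xn \<open>Z \<subseteq> Y\<close> \<open>N > 0\<close> \<open>\<epsilon> > 0\<close>
    by (force simp: bowen_cball_def bowen_dist_le_iff self)
  \<comment> \<open>Otherwise \<open>x j\<close> would lie in the ball around \<open>x i\<close> as
    well as in its own.\<close>
  have sep: "bowen_dist \<rho> g (n i) (x i) (x j) > \<epsilon>" if "i \<in> I" "j \<in> I" "i \<noteq> j" for i j
  proof (rule ccontr)
    assume "\<not> ?thesis"
    then have "x j \<in> bowen_cball Y \<rho> g (n i) (x i) \<epsilon>"
      using xn that \<open>Z \<subseteq> Y\<close> by (auto simp: bowen_cball_def)
    then show False using centre[OF that(2)] disj that unfolding disjoint_family_on_def by blast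
  qed
  have inj: "inj_on x I"
    using sep centre disj unfolding inj_on_def disjoint_family_on_def by (metis disjoint_iff)
  \<comment> \<open>The infinite sum is the supremum of its finite partial sums, and a finite F has
    a largest length, so grouping by length stays finite.\<close>
  have "(\<Sum>i\<in>F. ennreal (exp (- s * real (n i)))) \<le> ?B" if "finite F" "F \<subseteq> I" for F
  proof -
    define c where "c m = card {i \<in> F. n i = m}" for m
    have c: "c m \<le> sep_num \<rho> g Z m \<epsilon>" if "m \<ge> N" for m
    proof -
      have "c m = card (x ` {i \<in> F. n i = m})"
        unfolding c_def using inj \<open>F \<subseteq> I\<close>
        by (subst card_image) (auto simp: inj_on_def subset_iff)
      also have "\<dots> \<le> sep_num \<rho> g Z m \<epsilon>"
      proof (rule card_le_sep_num)
        show "sep_bounded \<rho> g Z m \<epsilon>" using bdd that \<open>N > 0\<close> by simp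
        show "separated \<rho> g m \<epsilon> (x ` {i \<in> F. n i = m})"
          unfolding separated_def using sep \<open>F \<subseteq> I\<close> by (auto simp: subset_iff)
      qed (use \<open>F \<subseteq> I\<close> xn \<open>finite F\<close> in auto)
      finally show ?thesis .
    qed
    define K where "K = Suc (Max (insert 0 (n ` F)))"
    have nK: "n i < K" if "i \<in> F" for i
      unfolding K_def using that \<open>finite F\<close> by (auto simp: less_Suc_eq_le intro!: Max_ge)
    have "(\<Sum>i\<in>F. exp (- s * real (n i))) = (\<Sum>m\<in>{N..<K + N}. \<Sum>i\<in>{i\<in>F. n i = m}. exp (- s * real (n i)))"
      using \<open>finite F\<close> \<open>F \<subseteq> I\<close> xn nK by (intro sum.group[symmetric]) (auto simp: trans_less_add1 subset_iff)
    also have "\<dots> = (\<Sum>m\<in>{N..<K + N}. real (c m) * exp (- s * real m))"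
      unfolding c_def by (intro sum.cong refl) simp
    also have "\<dots> \<le> (\<Sum>m\<in>{N..<K + N}. real (sep_num \<rho> g Z m \<epsilon>) * exp (- s * real m))"
      by (intro sum_mono mult_right_mono) (use c in auto)
    also have "\<dots> = (\<Sum>k<K. real (sep_num \<rho> g Z (k + N) \<epsilon>) * exp (- s * real (k + N)))"
      using sum.shift_bounds_nat_ivl[of "\<lambda>m. real (sep_num \<rho> g Z m \<epsilon>) * exp (- s * real m)" 0 N K]
      by (simp add: atLeast0LessThan)
    finally have "ennreal (\<Sum>i\<in>F. exp (- s * real (n i)))
        \<le> ennreal (\<Sum>k<K. real (sep_num \<rho> g Z (k + N) \<epsilon>) * exp (- s * real (k + N)))"
      by (rule ennreal_leI)
    also have "\<dots> = (\<Sum>k<K. ennreal (real (sep_num \<rho> g Z (k + N) \<epsilon>) * exp (- s * real (k + N))))"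
      by (subst sum_ennreal) auto
    also have "\<dots> \<le> ?B" by (rule sum_le_suminf) auto
    finally show ?thesis by (subst sum_ennreal) auto
  qed
  then show "(\<Sum>\<^sub>\<infinity>i\<in>I. ennreal (exp (- s * real (n i)))) \<le> ?B"
    by (subst nonneg_infsum_complete) (auto intro!: SUP_least)
qed

text \<open>For t strictly between the entropy and s, eventually \<open>sep_num\<close> is at most
  exp (t m), so the packing sums are dominated by the tail of a geometric series with ratio exp (t -
  s).\<close>

lemma packing_sum_eq_0:
  assumes bdd: "\<And>n. n > 0 \<Longrightarrow> sep_bounded \<rho> g Z n \<epsilon>"
    and "Z \<subseteq> Y" and self: "\<And>x. \<rho> x x = 0" and "\<epsilon> > 0"
    and less: "entropy_UC \<rho> g Z \<epsilon> < ereal s"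
  shows "packing_sum Y \<rho> g Z s \<epsilon> = 0"
proof -
  obtain t where t: "entropy_UC \<rho> g Z \<epsilon> < ereal t" "t < s"
    using ereal_dense2[OF less] by auto
  have "\<forall>\<^sub>F n in sequentially. 1 / real n * ln (real (sep_num \<rho> g Z n \<epsilon>)) < t"
    using Limsup_lessD[OF t(1)[unfolded entropy_UC_def]] by simp
  then obtain N0 where N0: "\<And>n. n \<ge> N0 \<Longrightarrow> 1 / real n * ln (real (sep_num \<rho> g Z n \<epsilon>)) < t"
    unfolding eventually_sequentially by blast
  define q where "q = exp (t - s)"
  have q: "0 < q" "q < 1" unfolding q_def using t by auto
  have le: "packing_sum_N Y \<rho> g Z s N \<epsilon> \<le> ennreal (q ^ N / (1 - q))" if N: "N \<ge> Suc N0" for N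
  proof -
    have term_le: "real (sep_num \<rho> g Z m \<epsilon>) * exp (- s * real m) \<le> q ^ m" if "m \<ge> N" for m
    \<comment> \<open>A bound on \<open>ln\<close> does not control the value 0, as
      \<open>ln 0 = 0\<close>; there the term itself vanishes.\<close>
    proof (cases "sep_num \<rho> g Z m \<epsilon> = 0")
      case False
      have "m > 0" using N that by simp
      then have "ln (real (sep_num \<rho> g Z m \<epsilon>)) \<le> t * real m"
        using N0[of m] N that by (simp add: divide_simps mult.commute)
      then have "real (sep_num \<rho> g Z m \<epsilon>) \<le> exp (t * real m)"
        using False by (metis exp_ln exp_le_cancel_iff of_nat_0_less_iff neq0_conv)
      then have "real (sep_num \<rho> g Z m \<epsilon>) * exp (- s * real m) \<le> exp (t * real m) * exp (- s * real m)"
        by (rule mult_right_mono) simp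
      also have "\<dots> = q ^ m"
        unfolding q_def exp_of_nat_mult[symmetric] mult_exp_exp by (simp add: algebra_simps)
      finally show ?thesis .
    qed (use q in simp)
    have "(\<Sum>k. ennreal (real (sep_num \<rho> g Z (k + N) \<epsilon>) * exp (- s * real (k + N)))) \<le> (\<Sum>k. ennreal (q ^ (k + N)))"
      by (intro suminf_le ennreal_leI term_le) auto
    also have "\<dots> = ennreal (q ^ N / (1 - q))"
    proof (rule suminf_ennreal_eq)
      show "(\<lambda>k. q ^ (k + N)) sums (q ^ N / (1 - q))"
        using sums_mult2[OF geometric_sums[of q], of "q ^ N"] q by (simp add: power_add)
    qed (use q in simp)
    finally have "(\<Sum>k. ennreal (real (sep_num \<rho> g Z (k + N) \<epsilon>) * exp (- s * real (k + N))))
        \<le> ennreal (q ^ N / (1 - q))" .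
    moreover have "packing_sum_N Y \<rho> g Z s N \<epsilon>
        \<le> (\<Sum>k. ennreal (real (sep_num \<rho> g Z (k + N) \<epsilon>) * exp (- s * real (k + N))))"
      by (rule packing_sum_N_le) (use bdd \<open>Z \<subseteq> Y\<close> self \<open>\<epsilon> > 0\<close> N in auto)
    ultimately show ?thesis by (rule order_trans[rotated])
  qed
  have "(\<lambda>N. q ^ N / (1 - q)) \<longlonglongrightarrow> 0"
    by (rule tendsto_divide_zero[OF LIMSEQ_realpow_zero]) (use q in auto)
  then have "(\<lambda>N. ennreal (q ^ N / (1 - q))) \<longlonglongrightarrow> ennreal 0"
    by (rule tendsto_ennrealI)
  then have lim0: "(\<lambda>N. ennreal (q ^ N / (1 - q))) \<longlonglongrightarrow> 0" by simp
  have "(\<lambda>N. packing_sum_N Y \<rho> g Z s N \<epsilon>) \<longlonglongrightarrow> 0"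
  proof (rule tendsto_sandwich[OF _ _ tendsto_const lim0])
    show "\<forall>\<^sub>F N in sequentially. packing_sum_N Y \<rho> g Z s N \<epsilon> \<le> ennreal (q ^ N / (1 - q))"
      unfolding eventually_sequentially by (intro exI[of _ "Suc N0"] allI impI le)
  qed simp
  then show ?thesis unfolding packing_sum_def by (rule limI)
qed

text \<open>The constant cover by Z already has packing sum 0 at every s above the separated-set
  entropy.\<close>

lemma entropy_P_le_entropy_UC:
  assumes bdd: "\<And>n. n > 0 \<Longrightarrow> sep_bounded \<rho> g Z n \<epsilon>"
    and "Z \<subseteq> Y" and self: "\<And>x. \<rho> x x = 0" and "\<epsilon> > 0"
  shows "entropy_P Y \<rho> g Z \<epsilon> \<le> entropy_UC \<rho> g Z \<epsilon>"
proof (rule ccontr)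
  assume "\<not> ?thesis"
  then have "entropy_UC \<rho> g Z \<epsilon> < entropy_P Y \<rho> g Z \<epsilon>" by simp
  then obtain s where s: "entropy_UC \<rho> g Z \<epsilon> < ereal s" "ereal s < entropy_P Y \<rho> g Z \<epsilon>"
    using ereal_dense2 by blast
  have "0 < s"
    using entropy_UC_nonneg[of \<rho> g Z \<epsilon>] s(1) by (metis ereal_less(2) le_less_trans)
  have "packing_measure Y \<rho> g Z s \<epsilon> \<le> (\<Sum>i::nat. packing_sum Y \<rho> g Z s \<epsilon>)"
    unfolding packing_measure_def using \<open>Z \<subseteq> Y\<close> by (intro Inf_lower) (auto intro!: exI[of _ "\<lambda>_. Z"])
  also have "\<dots> = 0" by (subst packing_sum_eq_0) (use assms s(1) in auto)
  finally have "entropy_P Y \<rho> g Z \<epsilon> \<le> ereal s"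
    unfolding entropy_P_def using \<open>0 < s\<close> by (intro Inf_lower) auto
  then show False using s(2) by simp
qed

text \<open>Centres more than 2 \<epsilon> apart at some time have disjoint closed \<epsilon>-balls
  by the triangle inequality, so A is itself a packing, with all lengths equal to n.\<close>

lemma packing_sum_N_ge:
  assumes A: "finite A" "A \<subseteq> Z" "separated \<rho> g n (2 * \<epsilon>) A" and "N \<le> n" "0 < n"
    and tri: "\<And>x y z. \<rho> x z \<le> \<rho> x y + \<rho> y z" and sym: "\<And>x y. \<rho> x y = \<rho> y x"
  shows "ennreal (real (card A) * exp (- s * real n)) \<le> packing_sum_N Y \<rho> g Z s N \<epsilon>"
proof -
  obtain h where h: "bij_betw h {..<card A} A"
    using ex_bij_betw_nat_finite[OF A(1)] by (auto simp: atLeast0LessThan)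
  have "disjoint_family_on (\<lambda>i. bowen_cball Y \<rho> g n (h i) \<epsilon>) {..<card A}"
    unfolding disjoint_family_on_def
  proof (intro ballI impI)
    fix i j assume ij: "i \<in> {..<card A}" "j \<in> {..<card A}" "i \<noteq> j"
    then have "h i \<in> A" "h j \<in> A" "h i \<noteq> h j"
      using h by (auto simp: bij_betw_def inj_on_def)
    then have "bowen_dist \<rho> g n (h i) (h j) > 2 * \<epsilon>"
      using A(3) unfolding separated_def by blast
    then obtain p where p: "p < n" "\<rho> ((g ^^ p) (h i)) ((g ^^ p) (h j)) > 2 * \<epsilon>"
      unfolding less_bowen_dist_iff[OF \<open>0 < n\<close>] by blast
    show "bowen_cball Y \<rho> g n (h i) \<epsilon> \<inter> bowen_cball Y \<rho> g n (h j) \<epsilon> = {}"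
    proof (rule ccontr)
      assume "\<not> ?thesis"
      then obtain y where y: "y \<in> bowen_cball Y \<rho> g n (h i) \<epsilon>" "y \<in> bowen_cball Y \<rho> g n (h j) \<epsilon>" by blast
      then have "\<rho> ((g ^^ p) (h i)) ((g ^^ p) y) \<le> \<epsilon>" "\<rho> ((g ^^ p) (h j)) ((g ^^ p) y) \<le> \<epsilon>"
        unfolding bowen_cball_def using p(1) by (simp_all add: bowen_dist_le_iff[OF \<open>0 < n\<close>])
      then show False
        using p(2) tri[of "(g ^^ p) (h i)" "(g ^^ p) (h j)" "(g ^^ p) y"]
          sym[of "(g ^^ p) (h j)" "(g ^^ p) y"] by linarith
    qed
  qed
  moreover have "\<forall>i\<in>{..<card A}. h i \<in> Z \<and> n \<ge> N"
    using h A \<open>N \<le> n\<close> by (auto simp: bij_betw_def)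
  ultimately have "(\<Sum>\<^sub>\<infinity>i\<in>{..<card A}. ennreal (exp (- s * real n))) \<le> packing_sum_N Y \<rho> g Z s N \<epsilon>"
    unfolding packing_sum_N_def
    by (intro Sup_upper CollectI exI[of _ "{..<card A}"] exI[of _ h] exI[of _ "\<lambda>_. n"] conjI)
      (rule refl)
  moreover have "(\<Sum>\<^sub>\<infinity>i\<in>{..<card A}. ennreal (exp (- s * real n))) = of_nat (card A) * ennreal (exp (- s * real n))"
    by (subst infsum_finite) simp_all
  ultimately show ?thesis
    by (simp only: ennreal_mult[OF of_nat_0_le_iff exp_ge_zero] ennreal_of_nat_eq_real_of_nat)
qed

section \<open>Compact systems and their squares\<close>

locale compact_system =
  fixes X :: "'a::metric_space set" and f :: "'a \<Rightarrow> 'a"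
  assumes compact: "compact X" and cont: "continuous_on X f" and maps: "f ` X \<subseteq> X"
begin

lemma funpow_in: "x \<in> X \<Longrightarrow> (f ^^ i) x \<in> X"
  by (induction i) (use maps in auto)

lemma continuous_on_funpow: "continuous_on X (f ^^ i)"
proof (induction i)
  case (Suc i)
  have "continuous_on ((f ^^ i) ` X) f"
    by (rule continuous_on_subset[OF cont]) (auto simp: funpow_in)
  then show ?case using continuous_on_compose[OF Suc] by (simp add: o_def)
qed (simp add: continuous_on_id)

lemma orbit_modulus:
  assumes "e > 0"
  obtains \<delta> where "\<delta> > 0"
    "\<And>x y i. x \<in> X \<Longrightarrow> y \<in> X \<Longrightarrow> dist x y < \<delta> \<Longrightarrow> i < n \<Longrightarrow> dist ((f ^^ i) x) ((f ^^ i) y) < e"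
proof -
  have "\<exists>\<delta>>0. \<forall>x\<in>X. \<forall>y\<in>X. dist x y < \<delta> \<longrightarrow> (\<forall>i<n. dist ((f ^^ i) x) ((f ^^ i) y) < e)"
  proof (induction n)
    case (Suc n)
    then obtain d1 where d1: "d1 > 0"
      "\<forall>x\<in>X. \<forall>y\<in>X. dist x y < d1 \<longrightarrow> (\<forall>i<n. dist ((f ^^ i) x) ((f ^^ i) y) < e)" by blast
    have "uniformly_continuous_on X (f ^^ n)"
      using compact_uniformly_continuous continuous_on_funpow compact by blast
    then obtain d2 where d2: "d2 > 0" "\<forall>x\<in>X. \<forall>y\<in>X. dist y x < d2 \<longrightarrow> dist ((f ^^ n) y) ((f ^^ n) x) < e"
      unfolding uniformly_continuous_on_def using assms by meson
    show ?case
      using d1 d2 by (intro exI[of _ "min d1 d2"]) (auto simp: less_Suc_eq)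
  qed (auto intro: exI[of _ 1])
  then show ?thesis using that by blast
qed

text \<open>Points in a common ball of radius \<open>\<delta> / 2\<close> stay within e for n steps,
  so a separated set injects into the centres of a finite cover.\<close>

lemma sep_bounded_X:
  assumes "e > 0" "n > 0"
  shows "sep_bounded dist f X n e"
proof -
  obtain \<delta> where d: "\<delta> > 0"
    "\<And>x y i. x \<in> X \<Longrightarrow> y \<in> X \<Longrightarrow> dist x y < \<delta> \<Longrightarrow> i < n \<Longrightarrow> dist ((f ^^ i) x) ((f ^^ i) y) < e"
    using orbit_modulus[OF \<open>e > 0\<close>] by metis
  obtain K where K: "finite K" "X \<subseteq> (\<Union>c\<in>K. ball c (\<delta> / 2))"
    using compact[unfolded compact_eq_totally_bounded] d(1) by (meson half_gt_zero)
  define c where "c x = (SOME c. c \<in> K \<and> dist c x < \<delta> / 2)" for x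
  have c: "c x \<in> K \<and> dist (c x) x < \<delta> / 2" if "x \<in> X" for x
    unfolding c_def by (rule someI_ex) (use K that in \<open>auto simp: subset_iff\<close>)
  have "card E \<le> card K" if E: "E \<subseteq> X" "finite E" "separated dist f n e E" for E
  proof (rule card_inj_on_le)
    show "inj_on c E"
    proof (rule inj_onI, rule ccontr)
      fix x y assume xy: "x \<in> E" "y \<in> E" "c x = c y" "x \<noteq> y"
      then have "dist x y < \<delta>"
        using c[of x] c[of y] E(1) dist_triangle_half_r[of "c x" x \<delta> y] by auto
      then have "bowen_dist dist f n x y \<le> e"
        unfolding bowen_dist_le_iff[OF \<open>n > 0\<close>] using d(2)[of x y] xy E(1) by (auto intro: less_imp_le)
      then show False using E(3) xy unfolding separated_def by force
    qed
  qed (use c E K in auto)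
  then show ?thesis unfolding sep_bounded_def by blast
qed

text \<open>Assign to each coordinate a centre in a largest e-separated set. Pairs with the same two
  centres stay within 2 e, so a 2 e-separated set of pairs injects into the pairs of
  centres.\<close>

lemma card_separated_square_le:
  assumes "e > 0" "n > 0" and A: "A \<subseteq> X \<times> X" "finite A"
    "separated (max_dist dist) (map_prod f f) n (2 * e) A"
  shows "card A \<le> (sep_num dist f X n e)\<^sup>2"
proof -
  note bdd = sep_bounded_X[OF \<open>e > 0\<close> \<open>n > 0\<close>]
  obtain E where E: "E \<subseteq> X" "finite E" "separated dist f n e E" "card E = sep_num dist f X n e"
    using sep_num_attained[OF bdd] by metis
  \<comment> \<open>A point far from all of E could be added to it, contradicting that E has the
    largest cardinality.\<close>
  have "\<exists>c\<in>E. bowen_dist dist f n c x \<le> e" if "x \<in> X" for x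
  proof (rule ccontr)
    assume none: "\<not> ?thesis"
    have "bowen_dist dist f n x x \<le> e"
      using \<open>e > 0\<close> by (simp add: bowen_dist_le_iff[OF \<open>n > 0\<close>])
    then have "x \<notin> E" using none by blast
    have "e < bowen_dist dist f n c x" "e < bowen_dist dist f n x c" if "c \<in> E" for c
      using none that bowen_dist_dist_commute[of f n x c] by (force simp: not_le)+
    then have "separated dist f n e (insert x E)"
      using E(3) unfolding separated_def by blast
    then have "card (insert x E) \<le> card E"
      unfolding E(4) using that E by (intro card_le_sep_num[OF bdd]) auto
    then show False using \<open>x \<notin> E\<close> E(2) by simp
  qed
  then obtain c where c: "\<And>x. x \<in> X \<Longrightarrow> c x \<in> E \<and> bowen_dist dist f n (c x) x \<le> e" by metis
  have close: "dist ((f ^^ i) x) ((f ^^ i) y) \<le> 2 * e" if "x \<in> X" "y \<in> X" "c x = c y" "i < n" for x y i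
  proof -
    have "dist ((f ^^ i) (c x)) ((f ^^ i) x) \<le> e" "dist ((f ^^ i) (c x)) ((f ^^ i) y) \<le> e"
      using c[of x] c[of y] that by (auto simp: bowen_dist_le_iff[OF \<open>n > 0\<close>])
    then show ?thesis
      using dist_triangle3[of "(f ^^ i) x" "(f ^^ i) y" "(f ^^ i) (c x)"] by linarith
  qed
  have "card A \<le> card (E \<times> E)"
  proof (rule card_inj_on_le)
    show "inj_on (map_prod c c) A"
    proof (rule inj_onI, rule ccontr)
      fix p q assume pq: "p \<in> A" "q \<in> A" "map_prod c c p = map_prod c c q" "p \<noteq> q"
      then have "c (fst p) = c (fst q)" "c (snd p) = c (snd q)"
        by (simp_all add: prod_eq_iff)
      moreover have "fst p \<in> X" "fst q \<in> X" "snd p \<in> X" "snd q \<in> X"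
        using A(1) pq(1,2) by auto
      ultimately have "bowen_dist (max_dist dist) (map_prod f f) n p q \<le> 2 * e"
        unfolding bowen_dist_le_iff[OF \<open>n > 0\<close>] funpow_map_prod max_dist_def
        by (simp add: close)
      then show False using A(3) pq unfolding separated_def by force
    qed
    show "map_prod c c ` A \<subseteq> E \<times> E" using A(1) c by auto
  qed (use E in auto)
  then show ?thesis using E(4) by (simp add: card_cartesian_product power2_eq_square)
qed

lemma sep_bounded_square:
  assumes "e > 0" "n > 0" "Z \<subseteq> X \<times> X"
  shows "sep_bounded (max_dist dist) (map_prod f f) Z n e"
  unfolding sep_bounded_def
  using card_separated_square_le[of "e / 2" n] assms by (intro exI[of _ "(sep_num dist f X n (e / 2))\<^sup>2"]) auto

lemma sep_num_square_le:
  assumes "e > 0" "n > 0" "Z \<subseteq> X \<times> X"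
  shows "sep_num (max_dist dist) (map_prod f f) Z n e \<le> (sep_num dist f X n (e / 2))\<^sup>2"
proof -
  obtain A where A: "A \<subseteq> Z" "finite A" "separated (max_dist dist) (map_prod f f) n e A"
    "card A = sep_num (max_dist dist) (map_prod f f) Z n e"
    using sep_num_attained[OF sep_bounded_square[OF assms]] by metis
  have "card A \<le> (sep_num dist f X n (e / 2))\<^sup>2"
    by (rule card_separated_square_le) (use A assms in auto)
  then show ?thesis using A(4) by simp
qed

lemma entropy_UC_square_le:
  assumes "e > 0" "Z \<subseteq> X \<times> X"
  shows "entropy_UC (max_dist dist) (map_prod f f) Z e \<le> 2 * entropy_UC dist f X (e / 2)"
proof -
  have "1 / real n * ln (real (sep_num (max_dist dist) (map_prod f f) Z n e))
      \<le> 2 * (1 / real n * ln (real (sep_num dist f X n (e / 2))))" if "n > 0" for n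
  \<comment> \<open>Monotonicity of \<open>ln\<close> needs a positive argument. At 0 the left side
    is \<open>ln 0 = 0\<close>, and the right side is nonnegative.\<close>
  proof (cases "sep_num (max_dist dist) (map_prod f f) Z n e = 0")
    case False
    let ?s = "sep_num dist f X n (e / 2)"
    have le: "real (sep_num (max_dist dist) (map_prod f f) Z n e) \<le> (real ?s)\<^sup>2"
      using sep_num_square_le[OF assms(1) that assms(2)] by (metis of_nat_mono of_nat_power)
    have "ln (real (sep_num (max_dist dist) (map_prod f f) Z n e)) \<le> ln ((real ?s)\<^sup>2)"
      using False le by (intro ln_mono) auto
    also have "\<dots> = 2 * ln (real ?s)" using ln_realpow[of "real ?s" 2] le False by (cases "?s = 0") auto
    finally show ?thesis using \<open>n > 0\<close> by (simp add: field_simps)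
  next
    case True
    have "0 \<le> ln (real (sep_num dist f X n (e / 2)))"
      by (cases "sep_num dist f X n (e / 2)") auto
    then show ?thesis using True by simp
  qed
  then have "\<forall>\<^sub>F n in sequentially.
      ereal (1 / real n * ln (real (sep_num (max_dist dist) (map_prod f f) Z n e)))
      \<le> ereal 2 * ereal (1 / real n * ln (real (sep_num dist f X n (e / 2))))"
    by (intro eventually_sequentiallyI[of 1]) simp
  then have "entropy_UC (max_dist dist) (map_prod f f) Z e
      \<le> limsup (\<lambda>n. ereal 2 * ereal (1 / real n * ln (real (sep_num dist f X n (e / 2)))))"
    unfolding entropy_UC_def by (rule Limsup_mono)
  also have "\<dots> = ereal 2 * entropy_UC dist f X (e / 2)"
    unfolding entropy_UC_def by (subst limsup_ereal_mult_left) auto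
  finally show ?thesis by simp
qed

lemma entropy_square_le:
  assumes "e > 0" "Z \<subseteq> X \<times> X"
  shows "entropy S (X \<times> X) (max_dist dist) (map_prod f f) Z e \<le> 2 * entropy_UC dist f X (e / 2)"
proof -
  have "entropy_P (X \<times> X) (max_dist dist) (map_prod f f) Z e
      \<le> entropy_UC (max_dist dist) (map_prod f f) Z e"
    by (rule entropy_P_le_entropy_UC) (use assms sep_bounded_square in \<open>auto simp: max_dist_def\<close>)
  then show ?thesis
    using entropy_UC_square_le[OF assms] by (cases S) auto
qed

end

section \<open>Consequences of specification\<close>

locale specification_system = compact_system +
  assumes spec: "specification_property X dist f"
begin

lemma specification_gap:
  assumes "e > 0"
  obtains m :: nat where "m > 0" "\<And>(k::nat) a b x. k \<ge> 1 \<Longrightarrow>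
      \<forall>j\<in>{1..k}. a j \<le> b j \<and> x j \<in> X \<Longrightarrow> \<forall>j\<in>{1..<k}. b j + m \<le> a (j + 1) \<Longrightarrow>
      \<exists>z\<in>X. \<forall>j\<in>{1..k}. \<forall>p\<in>{0..b j - a j}. dist ((f ^^ p) (x j)) ((f ^^ (p + a j)) z) < e"
  using spec[unfolded specification_property_def, rule_format, OF assms] by blast

text \<open>The form of specification used most: visit x at time 0, then follow u from time m on.
  One m serves all x, u and n.\<close>

lemma shadowing_after:
  assumes "e > 0"
  obtains m where "m > 0"
    "\<And>x u n. x \<in> X \<Longrightarrow> u \<in> X \<Longrightarrow>
       \<exists>z\<in>X. dist x z < e \<and> (\<forall>p<n. dist ((f ^^ p) u) ((f ^^ (p + m)) z) < e)"
proof -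
  obtain m :: nat where m: "m > 0" and spec_m: "\<And>(k::nat) a b x. k \<ge> 1 \<Longrightarrow>
      \<forall>j\<in>{1..k}. a j \<le> b j \<and> x j \<in> X \<Longrightarrow> \<forall>j\<in>{1..<k}. b j + m \<le> a (j + 1) \<Longrightarrow>
      \<exists>z\<in>X. \<forall>j\<in>{1..k}. \<forall>p\<in>{0..b j - a j}. dist ((f ^^ p) (x j)) ((f ^^ (p + a j)) z) < e"
    by (rule specification_gap[OF assms]) (rule that)
  have "\<exists>z\<in>X. dist x z < e \<and> (\<forall>p<n. dist ((f ^^ p) u) ((f ^^ (p + m)) z) < e)"
    if "x \<in> X" "u \<in> X" for x u n
  proof -
    \<comment> \<open>The intervals are [0, 0] and [m, m + n], exactly m apart; the second has one
      time more than required, so that n = 0 is allowed.\<close>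
    let ?a = "\<lambda>j::nat. if j = 1 then 0 else m" and ?b = "\<lambda>j::nat. if j = 1 then 0 else m + n"
    have "\<exists>z\<in>X. \<forall>j\<in>{1..2}. \<forall>p\<in>{0..?b j - ?a j}.
        dist ((f ^^ p) (if j = 1 then x else u)) ((f ^^ (p + ?a j)) z) < e"
      by (rule spec_m) (use that in auto)
    then obtain z where z: "z \<in> X" and close: "\<And>j p. j \<in> {1..2} \<Longrightarrow> p \<in> {0..?b j - ?a j} \<Longrightarrow>
        dist ((f ^^ p) (if j = 1 then x else u)) ((f ^^ (p + ?a j)) z) < e" by blast
    show ?thesis using z close[of 1 0] close[of 2] by (intro bexI[of _ z]) auto
  qed
  then show ?thesis using that m by blast
qed

section \<open>Mean distance along pairs of orbits\<close>

definition gap :: "nat \<Rightarrow> 'a \<times> 'a \<Rightarrow> real" where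
  "gap n p = (\<Sum>i<n. dist ((f ^^ i) (fst p)) ((f ^^ i) (snd p)))"

lemma gap_shift:
  "gap (m + n) p = gap m p + (\<Sum>i<n. dist ((f ^^ (i + m)) (fst p)) ((f ^^ (i + m)) (snd p)))"
  unfolding gap_def by (induction n) (simp_all add: add.commute)

lemma gap_nonneg: "0 \<le> gap n p"
  unfolding gap_def by (simp add: sum_nonneg)

lemma continuous_on_gap: "continuous_on (X \<times> X) (gap n)"
  unfolding gap_def
  by (intro continuous_on_sum continuous_on_dist continuous_on_compose2[OF continuous_on_funpow]
      continuous_on_fst continuous_on_snd continuous_on_id) auto

text \<open>Both coordinates shadow the same orbit after an initial visit to x and y.\<close>

lemma small_gap_dense:
  assumes "e > 0" "\<eta> > 0" "x \<in> X" "y \<in> X"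
  shows "\<exists>p\<in>X \<times> X. dist x (fst p) < e \<and> dist y (snd p) < e \<and> (\<exists>n\<ge>N. n > 0 \<and> gap n p < \<eta> * real n)"
proof -
  \<comment> \<open>Two shadowing errors of \<open>\<eta> / 4\<close> use half of
    \<open>\<eta>\<close>; the other half is reserved for the first m times.\<close>
  define e' where "e' = min e (\<eta> / 4)"
  have e': "e' > 0" "e' \<le> e" "e' \<le> \<eta> / 4" unfolding e'_def using assms by auto
  obtain m where m: "m > 0" "\<And>x u n. x \<in> X \<Longrightarrow> u \<in> X \<Longrightarrow>
      \<exists>z\<in>X. dist x z < e' \<and> (\<forall>p<n. dist ((f ^^ p) u) ((f ^^ (p + m)) z) < e')"
    using shadowing_after[OF e'(1)] by metis
  obtain D where D: "\<And>u v. u \<in> X \<Longrightarrow> v \<in> X \<Longrightarrow> dist u v \<le> D"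
    using compact_imp_bounded[OF compact] by (auto simp: bounded_two_points)
  have "D \<ge> 0" using D[OF \<open>x \<in> X\<close> \<open>x \<in> X\<close>] by simp
  \<comment> \<open>The first m times contribute at most m D, which is below
    \<open>\<eta> / 2\<close> times n for such large n.\<close>
  obtain k :: nat where k: "real k > 2 * real m * D / \<eta>" using reals_Archimedean2 by blast
  define n where "n = max N k + 1"
  have n: "n \<ge> N" "n > 0" "real n > 2 * real m * D / \<eta>" unfolding n_def using k by (auto simp: max_def)
  obtain z where z: "z \<in> X" "dist x z < e'" "\<And>i. i < n \<Longrightarrow> dist ((f ^^ i) x) ((f ^^ (i + m)) z) < e'"
    using m(2)[OF \<open>x \<in> X\<close> \<open>x \<in> X\<close>] by metis
  obtain w where w: "w \<in> X" "dist y w < e'" "\<And>i. i < n \<Longrightarrow> dist ((f ^^ i) x) ((f ^^ (i + m)) w) < e'"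
    using m(2)[OF \<open>y \<in> X\<close> \<open>x \<in> X\<close>] by metis
  have "gap m (z, w) \<le> (\<Sum>i<m. D)"
    unfolding gap_def by (intro sum_mono D) (simp_all add: funpow_in z w)
  moreover have "(\<Sum>i<n. dist ((f ^^ (i + m)) z) ((f ^^ (i + m)) w)) \<le> (\<Sum>i<n. \<eta> / 2)"
  proof (rule sum_mono)
    fix i assume "i \<in> {..<n}"
    then show "dist ((f ^^ (i + m)) z) ((f ^^ (i + m)) w) \<le> \<eta> / 2"
      using z(3)[of i] w(3)[of i] e'(3) dist_triangle3[of "(f ^^ (i + m)) z" "(f ^^ (i + m)) w" "(f ^^ i) x"]
      by simp
  qed
  ultimately have "gap (m + n) (z, w) \<le> real m * D + real n * (\<eta> / 2)"
    unfolding gap_shift by simp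
  also have "\<dots> < \<eta> * real (m + n)"
  proof -
    have "2 * real m * D < \<eta> * real n" using n(3) \<open>\<eta> > 0\<close> by (simp add: divide_simps mult.commute)
    moreover have "0 \<le> \<eta> * real m" using \<open>\<eta> > 0\<close> by simp
    ultimately show ?thesis by (simp add: algebra_simps)
  qed
  finally show ?thesis
    using z w n e' by (intro bexI[of _ "(z, w)"] conjI exI[of _ "m + n"]) auto
qed

text \<open>Shadowing two distinct points p and q at all multiples of m.\<close>

lemma large_gap_exists:
  assumes "p \<in> X" "q \<in> X" "p \<noteq> q"
  obtains c where "c > 0" "\<And>N. \<exists>z\<in>X. \<exists>w\<in>X. \<exists>n\<ge>N. n > 0 \<and> c * real n \<le> gap n (z, w)"
proof -
  define d where "d = dist p q"
  have "d / 4 > 0" unfolding d_def using assms by simp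
  then obtain m :: nat where m: "m > 0" and spec_m: "\<And>(k::nat) a b x. k \<ge> 1 \<Longrightarrow>
      \<forall>j\<in>{1..k}. a j \<le> b j \<and> x j \<in> X \<Longrightarrow> \<forall>j\<in>{1..<k}. b j + m \<le> a (j + 1) \<Longrightarrow>
      \<exists>z\<in>X. \<forall>j\<in>{1..k}. \<forall>p\<in>{0..b j - a j}. dist ((f ^^ p) (x j)) ((f ^^ (p + a j)) z) < d / 4"
    by (rule specification_gap) (rule that)
  have visit: "\<exists>z\<in>X. \<forall>j<k. dist u ((f ^^ (j * m)) z) < d / 4" if "u \<in> X" for u and k :: nat
  proof -
    \<comment> \<open>One-point intervals at 0, m, ..., k m. Taking \<open>Suc k\<close> of them
      meets the demand for at least one interval even when k = 0.\<close>
    have "\<exists>z\<in>X. \<forall>j\<in>{1..Suc k}. \<forall>p\<in>{0..(j - 1) * m - (j - 1) * m}. dist ((f ^^ p) u) ((f ^^ (p + (j - 1) * m)) z) < d / 4"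
      by (rule spec_m) (use that in \<open>auto simp: algebra_simps diff_mult_distrib\<close>)
    then obtain z where "z \<in> X" and z: "\<And>j. j \<in> {1..Suc k} \<Longrightarrow> dist u ((f ^^ ((j - 1) * m)) z) < d / 4"
      by fastforce
    have "dist u ((f ^^ (j * m)) z) < d / 4" if "j < k" for j using z[of "Suc j"] that by simp
    then show ?thesis using \<open>z \<in> X\<close> by blast
  qed
  have "\<exists>z\<in>X. \<exists>w\<in>X. \<exists>n\<ge>N. n > 0 \<and> d / (2 * real m) * real n \<le> gap n (z, w)" for N
  proof -
    define k where "k = Suc N"
    obtain z where z: "z \<in> X" "\<And>j. j < k \<Longrightarrow> dist p ((f ^^ (j * m)) z) < d / 4"
      using visit[OF assms(1)] by metis
    obtain w where w: "w \<in> X" "\<And>j. j < k \<Longrightarrow> dist q ((f ^^ (j * m)) w) < d / 4"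
      using visit[OF assms(2)] by metis
    let ?g = "\<lambda>i. dist ((f ^^ i) z) ((f ^^ i) w)"
    have "(\<Sum>j<k. d / 2) \<le> (\<Sum>j<k. ?g (j * m))"
    proof (rule sum_mono)
      fix j assume "j \<in> {..<k}"
      then show "d / 2 \<le> ?g (j * m)"
        using z(2)[of j] w(2)[of j] dist_triangle[of p q "(f ^^ (j * m)) z"]
          dist_triangle[of "(f ^^ (j * m)) z" q "(f ^^ (j * m)) w"]
        unfolding d_def by (simp add: dist_commute)
    qed
    also have "\<dots> = sum ?g ((\<lambda>j. j * m) ` {..<k})"
      using m by (subst sum.reindex) (auto simp: inj_on_def)
    also have "\<dots> \<le> gap (k * m) (z, w)"
      unfolding gap_def fst_conv snd_conv using m by (intro sum_mono2) auto
    \<comment> \<open>The k visits, each contributing at least d / 2, spread over k m times give a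
      mean of d / (2 m), whatever N is.\<close>
    finally have "d / (2 * real m) * real (k * m) \<le> gap (k * m) (z, w)"
      using m by (simp add: field_simps)
    moreover have "N * 1 \<le> k * m" unfolding k_def by (rule mult_le_mono) (use m in auto)
    then have "k * m \<ge> N" by simp
    moreover have "k * m > 0" using m unfolding k_def by simp
    ultimately show ?thesis using z(1) w(1) by blast
  qed
  moreover have "d / (2 * real m) > 0" using m \<open>d / 4 > 0\<close> by simp
  ultimately show ?thesis using that by blast
qed

text \<open>A finite pair of orbits with large mean distance is transplanted into any box by
  shadowing it after the delay. It matters that c is chosen before the box and before N: membership
  in MLY needs a single c for all N.\<close>

lemma large_gap_dense:
  assumes "p \<in> X" "q \<in> X" "p \<noteq> q"
  obtains c where "c > 0" "\<And>x y e N. x \<in> X \<Longrightarrow> y \<in> X \<Longrightarrow> e > 0 \<Longrightarrow>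
    \<exists>p\<in>X \<times> X. dist x (fst p) < e \<and> dist y (snd p) < e \<and> (\<exists>n\<ge>N. n > 0 \<and> c * real n < gap n p)"
proof -
  obtain c where c: "c > 0" "\<And>N. \<exists>z\<in>X. \<exists>w\<in>X. \<exists>n\<ge>N. n > 0 \<and> c * real n \<le> gap n (z, w)"
    using large_gap_exists[OF assms] by metis
  have "\<exists>p\<in>X \<times> X. dist x (fst p) < e \<and> dist y (snd p) < e \<and> (\<exists>n\<ge>N. n > 0 \<and> c / 4 * real n < gap n p)"
    if "x \<in> X" "y \<in> X" "e > 0" for x y e N
  proof -
    \<comment> \<open>Two errors of c / 8 leave a mean of 3 c / 4 over n times. As n is taken at
      least m, the delay at most doubles the time, so more than c / 4 remains.\<close>
    define e' where "e' = min e (c / 8)"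
    have e': "e' > 0" "e' \<le> e" "e' \<le> c / 8" unfolding e'_def using that c by auto
    obtain m where m: "m > 0" "\<And>x u n. x \<in> X \<Longrightarrow> u \<in> X \<Longrightarrow>
        \<exists>z\<in>X. dist x z < e' \<and> (\<forall>p<n. dist ((f ^^ p) u) ((f ^^ (p + m)) z) < e')"
      using shadowing_after[OF e'(1)] by metis
    obtain u v n where uv: "u \<in> X" "v \<in> X" "n \<ge> max N m" "n > 0" "c * real n \<le> gap n (u, v)"
      using c(2)[of "max N m"] by blast
    obtain z where z: "z \<in> X" "dist x z < e'" "\<And>i. i < n \<Longrightarrow> dist ((f ^^ i) u) ((f ^^ (i + m)) z) < e'"
      using m(2)[OF \<open>x \<in> X\<close> uv(1)] by metis
    obtain w where w: "w \<in> X" "dist y w < e'" "\<And>i. i < n \<Longrightarrow> dist ((f ^^ i) v) ((f ^^ (i + m)) w) < e'"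
      using m(2)[OF \<open>y \<in> X\<close> uv(2)] by metis
    have "gap n (u, v) \<le> (\<Sum>i<n. dist ((f ^^ (i + m)) z) ((f ^^ (i + m)) w) + c / 4)"
      unfolding gap_def fst_conv snd_conv
    proof (rule sum_mono)
      fix i assume "i \<in> {..<n}"
      then show "dist ((f ^^ i) u) ((f ^^ i) v) \<le> dist ((f ^^ (i + m)) z) ((f ^^ (i + m)) w) + c / 4"
        using z(3)[of i] w(3)[of i] e'(3)
          dist_triangle[of "(f ^^ i) u" "(f ^^ i) v" "(f ^^ (i + m)) z"]
          dist_triangle[of "(f ^^ (i + m)) z" "(f ^^ i) v" "(f ^^ (i + m)) w"]
        by (simp add: dist_commute)
    qed
    also have "\<dots> \<le> gap (m + n) (z, w) + real n * (c / 4)"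
      unfolding gap_shift fst_conv snd_conv sum.distrib using gap_nonneg[of m "(z, w)"] by simp
    finally have "c * real n * (3 / 4) \<le> gap (m + n) (z, w)"
      using uv(5) by (simp add: algebra_simps)
    moreover have "c / 4 * real (m + n) \<le> c * real n * (1 / 2)"
      using uv(3) c(1) by (simp add: field_simps)
    moreover have "0 < c * real n" using c(1) uv(4) by simp
    ultimately have "c / 4 * real (m + n) < gap (m + n) (z, w)" by linarith
    then show ?thesis
      using z w uv e' by (intro bexI[of _ "(z, w)"] conjI exI[of _ "m + n"]) auto
  qed
  then show ?thesis using that[of "c / 4"] c(1) by (metis divide_pos_pos zero_less_numeral)
qed

text \<open>This trades liminf and limsup for countably many conditions on finite sums. Each of them
  fails on a closed set, which is the form that Baire's theorem requires.\<close>

lemma in_MLY: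
  assumes "x \<in> X" "y \<in> X" "c > 0"
    and small: "\<And>k N :: nat. \<exists>n\<ge>N. n > 0 \<and> gap n (x, y) < real n / real (Suc k)"
    and large: "\<And>N :: nat. \<exists>n\<ge>N. n > 0 \<and> c * real n < gap n (x, y)"
  shows "(x, y) \<in> MLY X dist f"
proof -
  let ?A = "\<lambda>n. ereal (1 / real n * (\<Sum>i<n. dist ((f ^^ i) x) ((f ^^ i) y)))"
  have A: "?A n = ereal (gap n (x, y) / real n)" for n by (simp add: gap_def)
  have "0 \<le> liminf ?A"
    unfolding A by (intro Liminf_bounded) (simp add: gap_nonneg)
  moreover have "liminf ?A \<le> 0"
  proof (rule ccontr)
    assume "\<not> ?thesis"
    then have "0 < liminf ?A" by simp
    then obtain r where r: "0 < ereal r" "ereal r < liminf ?A" using ereal_dense2 by blast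
    obtain k where k: "inverse (real (Suc k)) < r" using reals_Archimedean r(1) by auto
    obtain N where N: "\<And>n. n \<ge> N \<Longrightarrow> r < gap n (x, y) / real n"
      using less_LiminfD[OF r(2)] unfolding A eventually_sequentially by auto
    obtain n where n: "n \<ge> N" "n > 0" "gap n (x, y) < real n / real (Suc k)" using small by blast
    then have "gap n (x, y) / real n < inverse (real (Suc k))" by (simp add: field_simps)
    then show False using N[OF n(1)] k by simp
  qed
  moreover have "limsup ?A > 0"
  proof (rule ccontr)
    assume "\<not> ?thesis"
    then have "limsup ?A < ereal c" using \<open>c > 0\<close> by (meson ereal_less(2) le_less_trans not_less)
    then obtain N where N: "\<And>n. n \<ge> N \<Longrightarrow> gap n (x, y) / real n < c"
      using Limsup_lessD[of sequentially ?A "ereal c"] unfolding A eventually_sequentially by auto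
    obtain n where n: "n \<ge> N" "n > 0" "c * real n < gap n (x, y)" using large by blast
    then show False using N[OF n(1)] by (simp add: field_simps)
  qed
  ultimately show ?thesis
    unfolding MLY_def using assms(1,2) by auto
qed

section \<open>Baire category in the square\<close>

lemma box_in_interior:
  assumes "top_of_set (X \<times> X) interior_of G \<noteq> {}"
  obtains x y e where "x \<in> X" "y \<in> X" "e > 0"
    "\<And>p. p \<in> X \<times> X \<Longrightarrow> dist x (fst p) < e \<Longrightarrow> dist y (snd p) < e \<Longrightarrow> p \<in> G"
proof -
  obtain U x y where U: "openin (top_of_set (X \<times> X)) U" "U \<subseteq> G" "(x, y) \<in> U"
    using assms by (auto simp: interior_of_def)
  then obtain e where e: "e > 0" "\<And>p. p \<in> X \<times> X \<Longrightarrow> dist p (x, y) < e \<Longrightarrow> p \<in> U"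
    unfolding openin_euclidean_subtopology_iff by metis
  \<comment> \<open>Openness on the product type refers to the Euclidean metric, which is at most
    the sum of the coordinate distances; hence the halves.\<close>
  have "p \<in> G" if "p \<in> X \<times> X" "dist x (fst p) < e / 2" "dist y (snd p) < e / 2" for p
  proof -
    have "dist p (x, y) \<le> dist (fst p) x + dist (snd p) y"
      using sqrt_sum_squares_le_sum[of "dist (fst p) x" "dist (snd p) y"]
      by (simp add: dist_prod_def)
    then have "dist p (x, y) < e" using that by (simp add: dist_commute)
    then show ?thesis using e(2) that(1) U(2) by blast
  qed
  then show ?thesis
    using that[of x y "e / 2"] e(1) U(1,3) openin_subset[OF U(1)] by auto
qed

lemma MLY_cover_somewhere_dense:
  assumes pq: "p \<in> X" "q \<in> X" "p \<noteq> q" and cover: "MLY X dist f \<subseteq> (\<Union>i::nat. W i)"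
  obtains i x y e where "x \<in> X" "y \<in> X" "e > 0"
    "\<And>p. p \<in> X \<times> X \<Longrightarrow> dist x (fst p) < e \<Longrightarrow> dist y (snd p) < e \<Longrightarrow> p \<in> closure (W i)"
proof -
  obtain c where c: "c > 0" "\<And>x y e N. x \<in> X \<Longrightarrow> y \<in> X \<Longrightarrow> e > 0 \<Longrightarrow>
      \<exists>p\<in>X \<times> X. dist x (fst p) < e \<and> dist y (snd p) < e \<and> (\<exists>n\<ge>N. n > 0 \<and> c * real n < gap n p)"
    using large_gap_dense[OF pq] by metis
  let ?S = "X \<times> X"
  let ?T = "top_of_set ?S"
  \<comment> \<open>C and D collect the pairs whose means fail, from N on, to become small or large.
    A pair outside all of them is in MLY by \<open>in_MLY\<close>, hence in some \<open>W i\<close>;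
    so C, D and the closures K form one countable closed cover of the square.\<close>
  define C where "C = (\<lambda>(k, N). {p \<in> ?S. \<forall>n\<ge>N. n > 0 \<longrightarrow> real n / real (Suc k) \<le> gap n p})"
  define D where "D N = {p \<in> ?S. \<forall>n\<ge>N. n > 0 \<longrightarrow> gap n p \<le> c * real n}" for N
  define K where "K i = ?S \<inter> closure (W i)" for i
  define \<G> where "\<G> = range C \<union> range D \<union> range K"
  have "compact ?S" by (intro compact_Times compact)
  then have "closed ?S" by (rule compact_imp_closed)
  have closedC: "closed (C j)" for j
  proof -
    obtain k N where j: "j = (k, N)" by fastforce
    have "C j = ?S \<inter> (\<Inter>n\<in>{n. n \<ge> N \<and> n > 0}. {p \<in> ?S. real n / real (Suc k) \<le> gap n p})"
      unfolding C_def j by auto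
    also have "closed \<dots>"
      by (intro closed_Int closed_INT ballI continuous_on_closed_Collect_le continuous_on_const
          continuous_on_gap \<open>closed ?S\<close>)
    finally show ?thesis .
  qed
  have closedD: "closed (D N)" for N
  proof -
    have "D N = ?S \<inter> (\<Inter>n\<in>{n. n \<ge> N \<and> n > 0}. {p \<in> ?S. gap n p \<le> c * real n})"
      unfolding D_def by auto
    also have "closed \<dots>"
      by (intro closed_Int closed_INT ballI continuous_on_closed_Collect_le continuous_on_const
          continuous_on_gap \<open>closed ?S\<close>)
    finally show ?thesis .
  qed
  have closedin: "closedin ?T G" if "G \<in> \<G>" for G
  proof (rule closed_subset)
    show "G \<subseteq> ?S" using that unfolding \<G>_def C_def D_def K_def by auto
    show "closed G"
      using that closedC closedD \<open>closed ?S\<close> unfolding \<G>_def K_def by (auto intro: closed_Int)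
  qed
  have "?S \<subseteq> \<Union>\<G>"
  proof
    fix p assume "p \<in> ?S"
    then obtain x y where p: "p = (x, y)" "x \<in> X" "y \<in> X" by blast
    show "p \<in> \<Union>\<G>"
    proof (rule ccontr)
      assume no: "p \<notin> \<Union>\<G>"
      then have "p \<notin> C (k, N)" "p \<notin> D N" "p \<notin> K i" for k N i
        unfolding \<G>_def by auto
      then have "\<exists>n\<ge>N. n > 0 \<and> gap n p < real n / real (Suc k)" "\<exists>n\<ge>N. n > 0 \<and> c * real n < gap n p"
        "p \<notin> closure (W i)" for k N i
        using \<open>p \<in> ?S\<close> unfolding C_def D_def K_def by (force simp: not_le)+
      then have "p \<in> MLY X dist f" "p \<notin> (\<Union>i. W i)"
        using in_MLY[OF p(2,3) c(1)] closure_subset unfolding p(1) by blast+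
      then show False using cover by blast
    qed
  qed
  moreover have "\<Union>\<G> \<subseteq> ?S" unfolding \<G>_def C_def D_def K_def by auto
  ultimately have "\<Union>\<G> = topspace ?T" by auto
  then have "?T interior_of \<Union>\<G> = topspace ?T" using interior_of_topspace by metis
  then have "?T interior_of \<Union>\<G> \<noteq> {}" using pq(1) by auto
  moreover have "countable \<G>" unfolding \<G>_def by auto
  moreover have "locally_compact_space ?T \<and> regular_space ?T"
    using compact_imp_locally_compact_space compact_Hausdorff_imp_regular_space
      Hausdorff_space_subtopology[OF Hausdorff_space_euclidean] \<open>compact ?S\<close>
    by (metis compact_space_subtopology compactin_euclidean_iff)
  ultimately obtain G where G: "G \<in> \<G>" "?T interior_of G \<noteq> {}"
    using Baire_category_alt[of ?T \<G>] closedin by blast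
  obtain x y e where box: "x \<in> X" "y \<in> X" "e > 0"
    "\<And>p. p \<in> ?S \<Longrightarrow> dist x (fst p) < e \<Longrightarrow> dist y (snd p) < e \<Longrightarrow> p \<in> G"
    using box_in_interior[OF G(2)] by metis
  \<comment> \<open>Neither C nor D contains a box, because pairs with small means, and pairs with
    large means, occur in every box. This leaves a closure of some \<open>W i\<close>.\<close>
  have "G \<notin> range C"
  proof
    assume "G \<in> range C"
    then obtain k N where "G = C (k, N)" by auto
    moreover obtain p where "p \<in> ?S" "dist x (fst p) < e" "dist y (snd p) < e"
        "\<exists>n\<ge>N. n > 0 \<and> gap n p < 1 / real (Suc k) * real n"
      using small_gap_dense[OF box(3) _ box(1,2), of "1 / real (Suc k)"] by fastforce
    ultimately show False using box(4)[of p] unfolding C_def by (force simp: not_le)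
  qed
  moreover have "G \<notin> range D"
  proof
    assume "G \<in> range D"
    then obtain N where "G = D N" by auto
    moreover obtain p where "p \<in> ?S" "dist x (fst p) < e" "dist y (snd p) < e"
        "\<exists>n\<ge>N. n > 0 \<and> c * real n < gap n p"
      using c(2)[OF box(1-3)] by metis
    ultimately show False using box(4)[of p] unfolding D_def by (force simp: not_le)
  qed
  ultimately obtain i where "G = K i" using G(1) unfolding \<G>_def by auto
  then show ?thesis using that[OF box(1-3), of i] box(4) unfolding K_def by blast
qed

section \<open>Lower bound for the packing entropy\<close>

text \<open>W is only dense in the box, so the shadowing pairs need not lie in it and are replaced
  by nearby points of W. Ball radius \<epsilon> asks for separation 2 \<epsilon>, and each of the
  two endpoints moves by at most \<epsilon>; hence the scale 4 \<epsilon>.\<close>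

lemma packing_sum_N_ge_sep_num:
  assumes "x \<in> X" "y \<in> X" "e > 0" "\<epsilon> > 0" "W \<subseteq> X \<times> X"
    and dense: "\<And>p. p \<in> X \<times> X \<Longrightarrow> dist x (fst p) < e \<Longrightarrow> dist y (snd p) < e \<Longrightarrow> p \<in> closure W"
  obtains m where "\<And>n N s. n > 0 \<Longrightarrow> N \<le> n \<Longrightarrow>
    ennreal ((real (sep_num dist f X n (4 * \<epsilon>)))\<^sup>2 * exp (- s * real (n + m)))
      \<le> packing_sum_N (X \<times> X) (max_dist dist) (map_prod f f) W s N \<epsilon>"
proof -
  \<comment> \<open>The bound e keeps the start inside the box; \<open>\<epsilon> / 2\<close> is one
    half of the permitted error, the other half being spent on the move into W.\<close>
  define e' where "e' = min e (\<epsilon> / 2)"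
  have e': "e' > 0" "e' \<le> e" "e' \<le> \<epsilon> / 2" unfolding e'_def using assms by auto
  obtain m where m: "m > 0" "\<And>x u n. x \<in> X \<Longrightarrow> u \<in> X \<Longrightarrow>
      \<exists>z\<in>X. dist x z < e' \<and> (\<forall>p<n. dist ((f ^^ p) u) ((f ^^ (p + m)) z) < e')"
    using shadowing_after[OF e'(1)] by metis
  have "ennreal ((real (sep_num dist f X n (4 * \<epsilon>)))\<^sup>2 * exp (- s * real (n + m)))
      \<le> packing_sum_N (X \<times> X) (max_dist dist) (map_prod f f) W s N \<epsilon>"
    if "n > 0" "N \<le> n" for n N s
  proof -
    have bdd: "sep_bounded dist f X n (4 * \<epsilon>)" using sep_bounded_X \<open>\<epsilon> > 0\<close> that by simp
    obtain E where E: "E \<subseteq> X" "finite E" "separated dist f n (4 * \<epsilon>) E"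
      "card E = sep_num dist f X n (4 * \<epsilon>)"
      using sep_num_attained[OF bdd] by metis
    \<comment> \<open>Here \<delta> may depend on n, since it only selects points of W; the delay m
      has been fixed before n.\<close>
    obtain \<delta> where \<delta>: "\<delta> > 0" "\<And>x y i. x \<in> X \<Longrightarrow> y \<in> X \<Longrightarrow> dist x y < \<delta> \<Longrightarrow> i < n + m \<Longrightarrow>
        dist ((f ^^ i) x) ((f ^^ i) y) < \<epsilon> / 2"
      using orbit_modulus[of "\<epsilon> / 2"] \<open>\<epsilon> > 0\<close> by (metis half_gt_zero)
    have "\<exists>w\<in>W. \<forall>i<n. dist ((f ^^ i) u) ((f ^^ (i + m)) (fst w)) < \<epsilon> \<and>
        dist ((f ^^ i) v) ((f ^^ (i + m)) (snd w)) < \<epsilon>" if uv: "u \<in> X" "v \<in> X" for u v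
    proof -
      obtain a where a: "a \<in> X" "dist x a < e'" "\<And>i. i < n \<Longrightarrow> dist ((f ^^ i) u) ((f ^^ (i + m)) a) < e'"
        using m(2)[OF \<open>x \<in> X\<close> uv(1)] by metis
      obtain b where b: "b \<in> X" "dist y b < e'" "\<And>i. i < n \<Longrightarrow> dist ((f ^^ i) v) ((f ^^ (i + m)) b) < e'"
        using m(2)[OF \<open>y \<in> X\<close> uv(2)] by metis
      have "(a, b) \<in> closure W" using a b e' by (intro dense) auto
      then obtain w where w: "w \<in> W" "dist w (a, b) < \<delta>"
        using \<delta>(1) unfolding closure_approachable by blast
      have near: "dist a (fst w) < \<delta>" "dist b (snd w) < \<delta>"
        using w(2) dist_fst_le[of w "(a, b)"] dist_snd_le[of w "(a, b)"] by (simp_all add: dist_commute)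
      have wX: "fst w \<in> X" "snd w \<in> X" using w(1) \<open>W \<subseteq> X \<times> X\<close> by auto
      have "dist ((f ^^ i) u) ((f ^^ (i + m)) (fst w)) < \<epsilon> \<and> dist ((f ^^ i) v) ((f ^^ (i + m)) (snd w)) < \<epsilon>"
        if "i < n" for i
        using a(3)[OF that] b(3)[OF that] e'(3) that
          \<delta>(2)[OF a(1) wX(1) near(1), of "i + m"] \<delta>(2)[OF b(1) wX(2) near(2), of "i + m"]
          dist_triangle[of "(f ^^ i) u" "(f ^^ (i + m)) (fst w)" "(f ^^ (i + m)) a"]
          dist_triangle[of "(f ^^ i) v" "(f ^^ (i + m)) (snd w)" "(f ^^ (i + m)) b"]
        by simp
      then show ?thesis using w(1) by blast
    qed
    then obtain w where w: "\<And>u v. u \<in> X \<Longrightarrow> v \<in> X \<Longrightarrow> w u v \<in> W \<and>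
        (\<forall>i<n. dist ((f ^^ i) u) ((f ^^ (i + m)) (fst (w u v))) < \<epsilon> \<and>
               dist ((f ^^ i) v) ((f ^^ (i + m)) (snd (w u v))) < \<epsilon>)" by metis
    let ?d = "bowen_dist (max_dist dist) (map_prod f f) (n + m)"
    have spread: "2 * \<epsilon> < dist a' b'" if "4 * \<epsilon> < dist a b" "dist a a' < \<epsilon>" "dist b b' < \<epsilon>"
      for a b a' b' :: 'a
      using that dist_triangle[of a b a'] dist_triangle[of a' b b'] by (simp add: dist_commute)
    have far: "2 * \<epsilon> < ?d (w u v) (w u' v')"
      if uv: "u \<in> E" "v \<in> E" "u' \<in> E" "v' \<in> E" "(u, v) \<noteq> (u', v')" for u v u' v'
    proof -
      have X: "u \<in> X" "v \<in> X" "u' \<in> X" "v' \<in> X" using uv E(1) by auto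
      consider "u \<noteq> u'" | "v \<noteq> v'" using uv by blast
      then have "\<exists>i<n. 2 * \<epsilon> < max_dist dist ((map_prod f f ^^ (i + m)) (w u v)) ((map_prod f f ^^ (i + m)) (w u' v'))"
      proof cases
        case 1
        then have "4 * \<epsilon> < bowen_dist dist f n u u'" using E(3) uv unfolding separated_def by blast
        then obtain i where i: "i < n" "4 * \<epsilon> < dist ((f ^^ i) u) ((f ^^ i) u')"
          unfolding less_bowen_dist_iff[OF \<open>n > 0\<close>] by blast
        have "2 * \<epsilon> < dist ((f ^^ (i + m)) (fst (w u v))) ((f ^^ (i + m)) (fst (w u' v')))"
          using spread[OF i(2)] w X i(1) by blast
        then show ?thesis using i(1) unfolding max_dist_def funpow_map_prod by auto
      next
        case 2
        then have "4 * \<epsilon> < bowen_dist dist f n v v'" using E(3) uv unfolding separated_def by blast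
        then obtain i where i: "i < n" "4 * \<epsilon> < dist ((f ^^ i) v) ((f ^^ i) v')"
          unfolding less_bowen_dist_iff[OF \<open>n > 0\<close>] by blast
        have "2 * \<epsilon> < dist ((f ^^ (i + m)) (snd (w u v))) ((f ^^ (i + m)) (snd (w u' v')))"
          using spread[OF i(2)] w X i(1) by blast
        then show ?thesis using i(1) unfolding max_dist_def funpow_map_prod by auto
      qed
      then obtain i where "i < n"
        "2 * \<epsilon> < max_dist dist ((map_prod f f ^^ (i + m)) (w u v)) ((map_prod f f ^^ (i + m)) (w u' v'))"
        by blast
      then show ?thesis
        using \<open>n > 0\<close> by (subst less_bowen_dist_iff) (auto intro!: exI[of _ "i + m"])
    qed
    define A where "A = case_prod w ` (E \<times> E)"
    \<comment> \<open>Pairs sent to the same point of W would be at distance 0 instead of more than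
      2 \<epsilon>; so no points are lost in the count.\<close>
    have "?d p p = 0" for p
      unfolding bowen_dist_def max_dist_def using \<open>n > 0\<close> by (simp add: image_constant_conv lessThan_empty_iff)
    then have "inj_on (case_prod w) (E \<times> E)"
      using far \<open>\<epsilon> > 0\<close> unfolding inj_on_def by (smt (verit) case_prod_conv mem_Sigma_iff old.prod.exhaust)
    then have cardA: "card A = (sep_num dist f X n (4 * \<epsilon>))\<^sup>2"
      unfolding A_def by (simp add: card_image card_cartesian_product E(4) power2_eq_square)
    have "separated (max_dist dist) (map_prod f f) (n + m) (2 * \<epsilon>) A"
      unfolding separated_def A_def using far by auto
    moreover have "w u v \<in> W" if "u \<in> E" "v \<in> E" for u v using w E(1) that by blast
    then have "A \<subseteq> W" unfolding A_def by auto
    moreover have "finite A" unfolding A_def using E(2) by simp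
    ultimately have "ennreal (real (card A) * exp (- s * real (n + m)))
        \<le> packing_sum_N (X \<times> X) (max_dist dist) (map_prod f f) W s N \<epsilon>"
      using that by (intro packing_sum_N_ge max_dist_triangle max_dist_commute) auto
    then show ?thesis unfolding cardA by simp
  qed
  then show ?thesis using that by blast
qed

text \<open>For s / 2 < t below the entropy there are arbitrarily large n with
  \<open>sep_num\<close> above exp (t n). Its square beats the weight exp (- s (n + m)) because 2 t
  > s.\<close>

lemma packing_sum_ge_1:
  assumes "x \<in> X" "y \<in> X" "e > 0" "\<epsilon> > 0" "W \<subseteq> X \<times> X"
    and "\<And>p. p \<in> X \<times> X \<Longrightarrow> dist x (fst p) < e \<Longrightarrow> dist y (snd p) < e \<Longrightarrow> p \<in> closure W"
    and "s > 0" "ereal s < 2 * entropy_UC dist f X (4 * \<epsilon>)"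
  shows "1 \<le> packing_sum (X \<times> X) (max_dist dist) (map_prod f f) W s \<epsilon>"
proof -
  obtain m where m: "\<And>n N s. n > 0 \<Longrightarrow> N \<le> n \<Longrightarrow>
    ennreal ((real (sep_num dist f X n (4 * \<epsilon>)))\<^sup>2 * exp (- s * real (n + m)))
      \<le> packing_sum_N (X \<times> X) (max_dist dist) (map_prod f f) W s N \<epsilon>"
    using packing_sum_N_ge_sep_num[OF assms(1-6)] by metis
  have "ereal (s / 2) < entropy_UC dist f X (4 * \<epsilon>)"
    using assms(8) by (cases "entropy_UC dist f X (4 * \<epsilon>)") auto
  then obtain t where t: "s / 2 < t" "ereal t < entropy_UC dist f X (4 * \<epsilon>)"
    using ereal_dense2 by (metis ereal_less_eq(3) not_le)
  have "1 \<le> packing_sum_N (X \<times> X) (max_dist dist) (map_prod f f) W s N \<epsilon>" for N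
  proof -
    \<comment> \<open>From this length on, the surplus (2 t - s) n pays for the delay s m.\<close>
    obtain k :: nat where k: "s * real m / (2 * t - s) < real k" using reals_Archimedean2 by blast
    \<comment> \<open>A limsup above t gives only infinitely many good n, but one beyond each N is
      enough.\<close>
    have "\<not> (\<forall>\<^sub>F n in sequentially. ereal (1 / real n * ln (real (sep_num dist f X n (4 * \<epsilon>)))) \<le> ereal t)"
      (is "\<not> ?bounded")
    proof
      assume ?bounded
      then have "entropy_UC dist f X (4 * \<epsilon>) \<le> ereal t"
        unfolding entropy_UC_def by (rule Limsup_bounded)
      then show False using t(2) by simp
    qed
    then obtain n where n: "n \<ge> Suc (N + k)" "t < 1 / real n * ln (real (sep_num dist f X n (4 * \<epsilon>)))"
      unfolding eventually_sequentially by (auto simp: not_le)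
    let ?s = "real (sep_num dist f X n (4 * \<epsilon>))"
    have "n > 0" "N \<le> n" using n by auto
    have ln_less: "t * real n < ln ?s" using n(2) \<open>n > 0\<close> by (simp add: divide_simps mult.commute)
    have "0 < t * real n" using t(1) \<open>s > 0\<close> \<open>n > 0\<close> by simp
    then have "0 < ?s" using ln_less by (cases "?s = 0") auto
    then have "exp (t * real n) < ?s" using ln_less by (metis exp_less_cancel_iff exp_ln)
    then have "(exp (t * real n))\<^sup>2 \<le> ?s\<^sup>2" by (intro power_mono) auto
    then have square: "exp (2 * t * real n) \<le> ?s\<^sup>2" by (simp add: exp_double[symmetric] mult.assoc)
    have "s * real m / (2 * t - s) \<le> real n" using k n(1) by simp
    then have "s * real (n + m) \<le> 2 * t * real n"
      using t(1) by (simp add: divide_le_eq algebra_simps)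
    then have "1 \<le> exp (2 * t * real n) * exp (- s * real (n + m))"
      unfolding mult_exp_exp by simp
    also have "\<dots> \<le> ?s\<^sup>2 * exp (- s * real (n + m))"
      using square by (intro mult_right_mono) auto
    finally have "1 \<le> ennreal (?s\<^sup>2 * exp (- s * real (n + m)))" by simp
    also have "\<dots> \<le> packing_sum_N (X \<times> X) (max_dist dist) (map_prod f f) W s N \<epsilon>"
      by (rule m) fact+
    finally show ?thesis .
  qed
  then show ?thesis unfolding packing_sum_eq_INF by (intro INF_greatest)
qed

end

context specification_system
begin

lemma entropy_P_MLY_ge:
  assumes "\<epsilon> > 0"
  shows "2 * entropy_UC dist f X (4 * \<epsilon>)
           \<le> entropy_P (X \<times> X) (max_dist dist) (map_prod f f) (MLY X dist f) \<epsilon>"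
proof (cases "\<exists>p\<in>X. \<exists>q\<in>X. p \<noteq> q")
  case True
  then obtain p q where pq: "p \<in> X" "q \<in> X" "p \<noteq> q" by blast
  let ?P = "packing_sum (X \<times> X) (max_dist dist) (map_prod f f)"
  show ?thesis
    unfolding entropy_P_def
  proof (rule Inf_greatest, clarify, rule ccontr)
    fix s :: real
    assume s: "s > 0" "\<not> 2 * entropy_UC dist f X (4 * \<epsilon>) \<le> ereal s"
      and 0: "packing_measure (X \<times> X) (max_dist dist) (map_prod f f) (MLY X dist f) s \<epsilon> = 0"
    have "1 \<le> (\<Sum>i. ?P (W i) s \<epsilon>)" if W: "\<forall>i. W i \<subseteq> X \<times> X" "MLY X dist f \<subseteq> (\<Union>i. W i)" for W :: "nat \<Rightarrow> _"
    proof -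
      obtain i x y e where box: "x \<in> X" "y \<in> X" "e > 0"
        "\<And>p. p \<in> X \<times> X \<Longrightarrow> dist x (fst p) < e \<Longrightarrow> dist y (snd p) < e \<Longrightarrow> p \<in> closure (W i)"
        using MLY_cover_somewhere_dense[OF pq W(2)] by metis
      have "1 \<le> ?P (W i) s \<epsilon>"
        using s W(1) by (intro packing_sum_ge_1[OF box(1-3) \<open>\<epsilon> > 0\<close> _ box(4)]) auto
      also have "\<dots> = (\<Sum>j\<in>{i}. ?P (W j) s \<epsilon>)" by simp
      also have "\<dots> \<le> (\<Sum>j. ?P (W j) s \<epsilon>)" by (rule sum_le_suminf) auto
      finally show ?thesis .
    qed
    then have "1 \<le> packing_measure (X \<times> X) (max_dist dist) (map_prod f f) (MLY X dist f) s \<epsilon>"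
      unfolding packing_measure_def by (intro Inf_greatest) blast
    then show False using 0 by simp
  qed
next
  case False
  \<comment> \<open>With at most one point in X there are no Li-Yorke pairs, so the bound has to
    come from the other side: separated sets have at most one element and the entropy of X is
    0.\<close>
  have "ln (real (sep_num dist f X n (4 * \<epsilon>))) \<le> 0" if "n > 0" for n
  proof -
    have bdd: "sep_bounded dist f X n (4 * \<epsilon>)" using sep_bounded_X \<open>\<epsilon> > 0\<close> that by simp
    obtain E where E: "E \<subseteq> X" "finite E" "card E = sep_num dist f X n (4 * \<epsilon>)"
      using sep_num_attained[OF bdd] by metis
    have "card E \<le> Suc 0"
      using False E(1,2) by (subst card_le_Suc0_iff_eq) blast+
    then show ?thesis using E(3) by (cases "card E") auto
  qed
  then have "entropy_UC dist f X (4 * \<epsilon>) \<le> 0"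
    unfolding entropy_UC_def
    by (intro Limsup_bounded eventually_sequentiallyI[of 1])
      (simp add: zero_ereal_def divide_nonpos_nonneg)
  then have "entropy_UC dist f X (4 * \<epsilon>) = 0"
    using entropy_UC_nonneg by (metis antisym)
  moreover have "0 \<le> entropy_P (X \<times> X) (max_dist dist) (map_prod f f) (MLY X dist f) \<epsilon>"
    unfolding entropy_P_def by (intro Inf_greatest) (auto simp: zero_ereal_def)
  ultimately show ?thesis by simp
qed

lemma MLY_subset: "MLY X dist f \<subseteq> X \<times> X"
  unfolding MLY_def by auto

lemma entropy_MLY_ge:
  assumes "\<epsilon> > 0"
  shows "2 * entropy_UC dist f X (4 * \<epsilon>)
           \<le> entropy S (X \<times> X) (max_dist dist) (map_prod f f) (MLY X dist f) \<epsilon>"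
proof -
  have "entropy_P (X \<times> X) (max_dist dist) (map_prod f f) (MLY X dist f) \<epsilon>
      \<le> entropy_UC (max_dist dist) (map_prod f f) (MLY X dist f) \<epsilon>"
    by (rule entropy_P_le_entropy_UC)
      (use assms sep_bounded_square MLY_subset in \<open>auto simp: max_dist_def\<close>)
  then show ?thesis
    using entropy_P_MLY_ge[OF assms] by (cases S) auto
qed

end

section \<open>Comparison at proportional scales\<close>

text \<open>The ratio of the two logarithms tends to 1. Stating this by products with z < 1 suits
  extended-real quotients, and z is sent to 1 at the very end.\<close>

lemma eventually_ln_rescale:
  fixes c z :: real
  assumes "c > 0" "0 < z" "z < 1"
  shows "\<forall>\<^sub>F e in at_right 0. e > 0 \<and> 0 < \<bar>ln e\<bar> \<and> 0 < \<bar>ln (c * e)\<bar> \<and>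
    z * \<bar>ln e\<bar> \<le> \<bar>ln (c * e)\<bar> \<and> z * \<bar>ln (c * e)\<bar> \<le> \<bar>ln e\<bar>"
proof -
  \<comment> \<open>The first two entries make both logarithms negative; the last two are the two
    product inequalities solved for \<open>ln e\<close>.\<close>
  define B where "B = min (min 0 (- ln c)) (min (z * ln c / (1 - z)) (- ln c / (1 - z)))"
  have "e > 0 \<and> 0 < \<bar>ln e\<bar> \<and> 0 < \<bar>ln (c * e)\<bar> \<and>
      z * \<bar>ln e\<bar> \<le> \<bar>ln (c * e)\<bar> \<and> z * \<bar>ln (c * e)\<bar> \<le> \<bar>ln e\<bar>" if e: "0 < e" "e < exp B" for e
  proof -
    have "ln e < B" using e by (metis exp_less_cancel_iff exp_ln)
    then have *: "ln e < 0" "ln e < - ln c" "ln e \<le> z * ln c / (1 - z)" "ln e \<le> - ln c / (1 - z)"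
      unfolding B_def by auto
    have "0 < 1 - z" using \<open>z < 1\<close> by simp
    then have "ln e * (1 - z) \<le> z * ln c" "ln e * (1 - z) \<le> - ln c"
      using *(3,4) by (simp_all only: pos_le_divide_eq)
    moreover have "ln (c * e) = ln c + ln e" using assms e by (simp add: ln_mult)
    ultimately show ?thesis using *(1,2) e by (simp add: algebra_simps)
  qed
  then show ?thesis
    unfolding eventually_at_right_field by (intro exI[of _ "exp B"]) auto
qed

lemma ereal_divide_scale_le:
  fixes h :: ereal
  assumes "0 \<le> h" "0 < a" "0 < b" "0 < z" "z * a \<le> b"
  shows "ereal z * (h / ereal b) \<le> h / ereal a"
proof (cases h)
  case (real r)
  have "r * (z * a) \<le> r * b" using assms real by (intro mult_left_mono) auto
  then have "z * (r / b) \<le> r / a" using assms by (simp add: field_simps)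
  then show ?thesis using real assms by simp
qed (use assms in auto)

lemma Limsup_at_right_rescale:
  fixes G :: "real \<Rightarrow> 'b::complete_linorder"
  assumes "c > 0"
  shows "Limsup (at_right 0) (\<lambda>e. G (c * e)) = Limsup (at_right 0) G"
  using Limsup_filtermap_eq[of "times c" "at_right 0" G] filtermap_times_pos_at_right[OF assms, of 0] assms
  by (simp add: inj_on_def)

lemma Liminf_at_right_rescale:
  fixes G :: "real \<Rightarrow> 'b::complete_linorder"
  assumes "c > 0"
  shows "Liminf (at_right 0) (\<lambda>e. G (c * e)) = Liminf (at_right 0) G"
  using Liminf_filtermap_eq[of "times c" "at_right 0" G] filtermap_times_pos_at_right[OF assms, of 0] assms
  by (simp add: inj_on_def)

lemma ereal_le_of_scaled_le:
  fixes x y :: ereal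
  assumes "0 \<le> y" "\<And>z::real. 0 < z \<Longrightarrow> z < 1 \<Longrightarrow> ereal z * x \<le> y"
  shows "x \<le> y"
proof (rule ereal_le_mult_one_interval)
  fix z :: ereal assume "0 < z" "z < 1"
  then show "z * x \<le> y" using assms(2)[of "real_of_ereal z"] by (cases z) auto
qed (use assms(1) in auto)

text \<open>Exchanging \<open>ln e\<close> for \<open>ln (c * e)\<close> in the denominator costs a
  factor z, and then a constant multiple of e is invisible to a limit at 0 from the right.\<close>

lemma mdim_eq_of_entropy_sandwich:
  fixes h H :: "real \<Rightarrow> ereal"
  assumes "c > 0" "d > 0" and h: "\<And>e. 0 \<le> h e"
    and lower: "\<And>e. e > 0 \<Longrightarrow> 2 * h (c * e) \<le> H e" and upper: "\<And>e. e > 0 \<Longrightarrow> H e \<le> 2 * h (d * e)"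
  shows "Limsup (at_right 0) (\<lambda>e. H e / ereal \<bar>ln e\<bar>) = 2 * Limsup (at_right 0) (\<lambda>e. h e / ereal \<bar>ln e\<bar>)"
    and "Liminf (at_right 0) (\<lambda>e. H e / ereal \<bar>ln e\<bar>) = 2 * Liminf (at_right 0) (\<lambda>e. h e / ereal \<bar>ln e\<bar>)"
proof -
  let ?F = "\<lambda>e. H e / ereal \<bar>ln e\<bar>" and ?G = "\<lambda>e. h e / ereal \<bar>ln e\<bar>"
  have G0: "0 \<le> ?G e" for e using h by (cases "ln e = 0") auto
  have ev_lower: "\<forall>\<^sub>F e in at_right 0. ereal (2 * z) * ?G (c * e) \<le> ?F e" if z: "0 < z" "z < 1" for z
    using eventually_ln_rescale[OF \<open>c > 0\<close> z]
  proof eventually_elim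
    case (elim e)
    have "ereal (2 * z) * ?G (c * e) = ereal z * (2 * h (c * e) / ereal \<bar>ln (c * e)\<bar>)"
      by (cases "h (c * e)") (use z elim in auto)
    also have "\<dots> \<le> 2 * h (c * e) / ereal \<bar>ln e\<bar>"
      by (rule ereal_divide_scale_le) (use elim z h in auto)
    also have "\<dots> \<le> ?F e" using lower[of e] elim by (intro ereal_divide_right_mono) auto
    finally show ?case .
  qed
  have ev_upper: "\<forall>\<^sub>F e in at_right 0. ereal z * ?F e \<le> ereal 2 * ?G (d * e)" if z: "0 < z" "z < 1" for z
    using eventually_ln_rescale[OF \<open>d > 0\<close> z]
  proof eventually_elim
    case (elim e)
    have "ereal z * ?F e \<le> ereal z * (2 * h (d * e) / ereal \<bar>ln e\<bar>)"
      using upper[of e] elim z by (intro ereal_mult_left_mono ereal_divide_right_mono) auto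
    also have "\<dots> \<le> 2 * h (d * e) / ereal \<bar>ln (d * e)\<bar>"
      by (rule ereal_divide_scale_le) (use elim z h in auto)
    also have "\<dots> = ereal 2 * ?G (d * e)" by (simp add: ereal_times_divide_eq)
    finally show ?case .
  qed
  have scale: "ereal z * (2 * x) = ereal (2 * z) * x" for x z
    by (simp only: times_ereal.simps(1)[symmetric] numeral_eq_ereal[symmetric] mult.assoc mult.left_commute)
  \<comment> \<open>Nonnegativity of the quotient, required by \<open>ereal_le_of_scaled_le\<close>,
    is read off from the lower comparison at the arbitrary choice z = 1 / 2.\<close>
  have F0: "\<forall>\<^sub>F e in at_right 0. 0 \<le> ?F e"
  proof (rule eventually_mono)
    show "\<forall>\<^sub>F e in at_right 0. ereal (2 * (1 / 2)) * ?G (c * e) \<le> ?F e" by (rule ev_lower) auto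
    show "0 \<le> ?F e" if "ereal (2 * (1 / 2)) * ?G (c * e) \<le> ?F e" for e
      using that by (rule order_trans[rotated]) (intro ereal_0_le_mult G0, simp)
  qed
  show "Limsup (at_right 0) ?F = 2 * Limsup (at_right 0) ?G"
  proof (rule antisym)
    show "Limsup (at_right 0) ?F \<le> 2 * Limsup (at_right 0) ?G"
    proof (rule ereal_le_of_scaled_le)
      have "0 \<le> Limsup (at_right 0) ?G" by (rule le_Limsup) (use G0 in auto)
      then show "0 \<le> 2 * Limsup (at_right 0) ?G" by simp
      fix z :: real assume z: "0 < z" "z < 1"
      have "Limsup (at_right 0) (\<lambda>e. ereal z * ?F e) \<le> Limsup (at_right 0) (\<lambda>e. ereal 2 * ?G (d * e))"
        by (rule Limsup_mono[OF ev_upper[OF z]])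
      then show "ereal z * Limsup (at_right 0) ?F \<le> 2 * Limsup (at_right 0) ?G"
        using z Limsup_at_right_rescale[OF \<open>d > 0\<close>, of ?G] by (simp add: Limsup_ereal_mult_left)
    qed
    show "2 * Limsup (at_right 0) ?G \<le> Limsup (at_right 0) ?F"
    proof (rule ereal_le_of_scaled_le)
      show "0 \<le> Limsup (at_right 0) ?F" by (rule le_Limsup) (use F0 in auto)
      fix z :: real assume z: "0 < z" "z < 1"
      have "Limsup (at_right 0) (\<lambda>e. ereal (2 * z) * ?G (c * e)) \<le> Limsup (at_right 0) ?F"
        by (rule Limsup_mono[OF ev_lower[OF z]])
      then show "ereal z * (2 * Limsup (at_right 0) ?G) \<le> Limsup (at_right 0) ?F"
        unfolding scale using z Limsup_at_right_rescale[OF \<open>c > 0\<close>, of ?G]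
        by (simp add: Limsup_ereal_mult_left)
    qed
  qed
  show "Liminf (at_right 0) ?F = 2 * Liminf (at_right 0) ?G"
  proof (rule antisym)
    show "Liminf (at_right 0) ?F \<le> 2 * Liminf (at_right 0) ?G"
    proof (rule ereal_le_of_scaled_le)
      have "0 \<le> Liminf (at_right 0) ?G" by (rule Liminf_bounded) (use G0 in auto)
      then show "0 \<le> 2 * Liminf (at_right 0) ?G" by simp
      fix z :: real assume z: "0 < z" "z < 1"
      have "Liminf (at_right 0) (\<lambda>e. ereal z * ?F e) \<le> Liminf (at_right 0) (\<lambda>e. ereal 2 * ?G (d * e))"
        by (rule Liminf_mono[OF ev_upper[OF z]])
      then show "ereal z * Liminf (at_right 0) ?F \<le> 2 * Liminf (at_right 0) ?G"
        using z Liminf_at_right_rescale[OF \<open>d > 0\<close>, of ?G] by (simp add: Liminf_ereal_mult_left)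
    qed
    show "2 * Liminf (at_right 0) ?G \<le> Liminf (at_right 0) ?F"
    proof (rule ereal_le_of_scaled_le)
      show "0 \<le> Liminf (at_right 0) ?F" by (rule Liminf_bounded) (use F0 in auto)
      fix z :: real assume z: "0 < z" "z < 1"
      have "Liminf (at_right 0) (\<lambda>e. ereal (2 * z) * ?G (c * e)) \<le> Liminf (at_right 0) ?F"
        by (rule Liminf_mono[OF ev_lower[OF z]])
      then show "ereal z * (2 * Liminf (at_right 0) ?G) \<le> Liminf (at_right 0) ?F"
        unfolding scale using z Liminf_at_right_rescale[OF \<open>c > 0\<close>, of ?G]
        by (simp add: Liminf_ereal_mult_left)
    qed
  qed
qed

theorem theorem4p3:
  fixes X :: "'a::metric_space set" and f f' :: "'a \<Rightarrow> 'a" and S :: entropy_kind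
  assumes "compact X"
    and "homeomorphism X X f f'"
    and "specification_property X dist f"
  shows "upper_mdim S (X \<times> X) (max_dist dist) (map_prod f f) (MLY X dist f)
           = 2 * upper_mdim UC X dist f X \<and>
         lower_mdim S (X \<times> X) (max_dist dist) (map_prod f f) (MLY X dist f)
           = 2 * lower_mdim UC X dist f X"
proof -
  interpret specification_system X f
    by unfold_locales (use assms in \<open>auto simp: homeomorphism_def\<close>)
  let ?H = "entropy S (X \<times> X) (max_dist dist) (map_prod f f) (MLY X dist f)"
  \<comment> \<open>The factor 4 stems from shadowing plus disjointness of balls, 1 / 2 from
    spanning the square by centres.\<close>
  have "2 * entropy_UC dist f X (4 * e) \<le> ?H e" "?H e \<le> 2 * entropy_UC dist f X (1 / 2 * e)" if "e > 0" for e
    using entropy_MLY_ge[OF that] entropy_square_le[OF that MLY_subset] by simp_all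
  note mdim_eq_of_entropy_sandwich[OF _ _ entropy_UC_nonneg this]
  then show ?thesis unfolding upper_mdim_def lower_mdim_def by simp
qed

end
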